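(* Let $G=(V,w)$ be a weighted graph, let $o\in V$ be a vertex and $z\subset V$ a vertex set with $\mathrm{dist}(o,z)\ge n+1$ for some integer $n\ge 0$. Let $g$ be either (a) the solution $g>1$ of $(g-1)^2g^{\,n-2}=2w_z/w_o$, or (b) $g=(w_z\,r_{oz})^{1/n}$ (for $n\ge 1$ and $r_{oz}<\infty$). Let $T'_{0n}$ be the hitting time of $n$ from $0$ for biased simple random walk on $\mathbb Z$ with odds $1$ and $g$ of going left and right. Then the Laplace transform of $T'_{0n}+1$ dominates that of $T_{oz}$: for every $\lambda\ge0$, $$\mathbf E\,e^{-\lambda(T'_{0n}+1)}\ \ge\ \mathbf E\,e^{-\lambda T_{oz}}.$$
   Context: A weighted graph $G=(V,w)$ is a set $V$ of vertices with a symmetric function $w:V\times V\to[0,\infty)$; the edges are the pairs on which $w$ is positive. The weight of a vertex is $w_x=\sum_y w(x,y)$ (with $0<w_x<\infty$), and the weight of a vertex set $z$ is $w_z=\sum_{x\in z}w_x$. The random walk on $G$ moves from $x$ to $y$ with probability $w(x,y)/w_x$. $T_{oz}$ is the first time the walk started at $o$ at time $0$ visits $z$, and $\mathrm{dist}$ is graph distance. $r_{oz}$ is the effective resistance between $o$ and $z$ (with $z$ regarded as a single vertex) in the electric network with conductances given by the edge weights. Biased simple random walk with odds $1$ and $g$ of going left and right steps $+1$ with probability $g/(g+1)$ and $-1$ with probability $1/(g+1)$. *)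

theory Defs
  imports "HOL-Probability.Probability"
begin

definition vertex_weight :: "'a set \<Rightarrow> ('a \<Rightarrow> 'a \<Rightarrow> real) \<Rightarrow> 'a \<Rightarrow> real" where
  "vertex_weight V w x = (\<Sum>\<^sub>\<infinity>y\<in>V. w x y)"

text \<open>A real-valued \<^const>\<open>infsum\<close> is 0 when the family is not summable, so summability is what
  expresses that vertex weights are finite.\<close>

definition weighted_graph :: "'a set \<Rightarrow> ('a \<Rightarrow> 'a \<Rightarrow> real) \<Rightarrow> bool" where
  "weighted_graph V w \<longleftrightarrow>
     (\<forall>x\<in>V. \<forall>y\<in>V. w x y = w y x \<and> 0 \<le> w x y) \<and>
     (\<forall>x\<in>V. (\<lambda>y. w x y) summable_on V \<and> 0 < vertex_weight V w x)"

definition set_weight :: "'a set \<Rightarrow> ('a \<Rightarrow> 'a \<Rightarrow> real) \<Rightarrow> 'a set \<Rightarrow> real" where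
  "set_weight V w z = (\<Sum>\<^sub>\<infinity>x\<in>z. vertex_weight V w x)"

definition edges :: "'a set \<Rightarrow> ('a \<Rightarrow> 'a \<Rightarrow> real) \<Rightarrow> ('a \<times> 'a) set" where
  "edges V w = {(x, y). x \<in> V \<and> y \<in> V \<and> 0 < w x y}"

text \<open>The infimum of the empty set is \<open>\<infinity>\<close> here and in \<open>hitting_time\<close>.\<close>

definition graph_dist :: "'a set \<Rightarrow> ('a \<Rightarrow> 'a \<Rightarrow> real) \<Rightarrow> 'a \<Rightarrow> 'a set \<Rightarrow> enat" where
  "graph_dist V w x z = (INF k\<in>{k. \<exists>y\<in>z. (x, y) \<in> edges V w ^^ k}. enat k)"

text \<open>\<open>X\<close> is a time-homogeneous Markov chain on a discrete state space, started at \<open>x0\<close>, with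
  transition probabilities \<open>p x y\<close>.\<close>

definition markov_chain ::
  "'m measure \<Rightarrow> (nat \<Rightarrow> 'm \<Rightarrow> 'a) \<Rightarrow> ('a \<Rightarrow> 'a \<Rightarrow> real) \<Rightarrow> 'a \<Rightarrow> bool" where
  "markov_chain M X p x0 \<longleftrightarrow>
     prob_space M \<and>
     (\<forall>k. X k \<in> measurable M (count_space UNIV)) \<and>
     (AE \<omega> in M. X 0 \<omega> = x0) \<and>
     (\<forall>k xs y. \<P>(\<omega> in M. (\<forall>i\<le>k. X i \<omega> = xs i) \<and> X (Suc k) \<omega> = y) =
        \<P>(\<omega> in M. \<forall>i\<le>k. X i \<omega> = xs i) * p (xs k) y)"

definition walk_prob :: "'a set \<Rightarrow> ('a \<Rightarrow> 'a \<Rightarrow> real) \<Rightarrow> 'a \<Rightarrow> 'a \<Rightarrow> real" where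
  "walk_prob V w x y = (if x \<in> V \<and> y \<in> V then w x y / vertex_weight V w x else 0)"

definition biased_prob :: "real \<Rightarrow> int \<Rightarrow> int \<Rightarrow> real" where
  "biased_prob g x y =
     (if y = x + 1 then g / (g + 1) else if y = x - 1 then 1 / (g + 1) else 0)"

definition hitting_time :: "(nat \<Rightarrow> 'm \<Rightarrow> 'a) \<Rightarrow> 'a set \<Rightarrow> 'm \<Rightarrow> enat" where
  "hitting_time X A \<omega> = (INF k\<in>{k. X k \<omega> \<in> A}. enat k)"

text \<open>Expectation of \<open>exp (- a T)\<close>, where \<open>exp (- a T)\<close> is read as 0 on \<open>T = \<infinity>\<close>, also for
  \<open>a = 0\<close>.\<close>

definition laplace :: "'m measure \<Rightarrow> ('m \<Rightarrow> enat) \<Rightarrow> real \<Rightarrow> real" where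
  "laplace M T a = (\<integral>\<omega>. (case T \<omega> of enat k \<Rightarrow> exp (- a * real k) | \<infinity> \<Rightarrow> 0) \<partial>M)"

text \<open>Voltages on the finite subnetwork induced on \<open>W\<close> when \<open>z\<close> is short-circuited and grounded
  and a unit current is sent in at \<open>x0\<close>: Kirchhoff's node law together with Ohm's law at every
  vertex outside \<open>z\<close>.\<close>

definition unit_voltage ::
  "('a \<Rightarrow> 'a \<Rightarrow> real) \<Rightarrow> 'a \<Rightarrow> 'a set \<Rightarrow> 'a set \<Rightarrow> ('a \<Rightarrow> real) \<Rightarrow> bool" where
  "unit_voltage w x0 z W v \<longleftrightarrow>
     (\<forall>x\<in>W \<inter> z. v x = 0) \<and>
     (\<forall>x\<in>W - z. (\<Sum>y\<in>W. w x y * (v x - v y)) = (if x = x0 then 1 else 0))"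

text \<open>For \<open>x0 \<in> W - z\<close> the value \<open>v x0\<close> is the same for all unit voltages \<open>v\<close> on \<open>W\<close>, and there is
  no unit voltage (so that the infimum is \<open>\<infinity>\<close>) iff \<open>z\<close> is not connected to \<open>x0\<close> within \<open>W\<close>.\<close>

definition finite_resistance ::
  "('a \<Rightarrow> 'a \<Rightarrow> real) \<Rightarrow> 'a \<Rightarrow> 'a set \<Rightarrow> 'a set \<Rightarrow> ennreal" where
  "finite_resistance w x0 z W = (INF v\<in>{v. unit_voltage w x0 z W v}. ennreal (v x0))"

text \<open>The limit of the resistances of the finite subnetworks as these exhaust \<open>V\<close>. They decrease
  (Rayleigh), so the limit exists and agrees with the limes inferior. For finite \<open>V\<close> this is
  simply the value at \<open>W = V\<close>.\<close>

definition effective_resistance ::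
  "'a set \<Rightarrow> ('a \<Rightarrow> 'a \<Rightarrow> real) \<Rightarrow> 'a \<Rightarrow> 'a set \<Rightarrow> ennreal" where
  "effective_resistance V w x0 z =
     Liminf (finite_subsets_at_top V) (finite_resistance w x0 z)"

end

theory Submission
  imports Defs
begin

text \<open>
  Put \<open>s = exp (- a)\<close>, and let \<open>T\<close> be the hitting time of \<open>z\<close> from \<open>x0\<close>. The proof compares the two transforms by
  a differential inequality in \<open>s\<close> for which the biased walk on the line is the case of equality.

  Let \<open>f x\<close> be the expectation of \<open>s ^ T\<close> for the walk from \<open>x\<close>, and \<open>u x\<close> the discounted Green function from
  \<open>x0\<close> divided by the weight of \<open>x\<close>. Both satisfy the same linear equation off \<open>x0\<close> and \<open>z\<close>, so
  \<open>j x y = s * w x y * (u x * f y - u y * f x) / f x0\<close> is a unit flow from \<open>x0\<close> to \<open>z\<close>, and it runs down the ratio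
  \<open>R = u / f\<close>. The logarithmic derivative \<open>s * (d/ds) (ln (f x0))\<close> is the mean duration of the walk whose law is
  tilted by \<open>s ^ T\<close>, and it is at least one (the last step) plus the sum over the other edges, each taken in the direction
  of \<open>j\<close>, of \<open>j x y * (R x + R y) / (R x - R y)\<close>. The last quotient is \<open>coth (l / 2)\<close> for the drop \<open>l\<close> of \<open>ln R\<close>
  along the edge. The flow crosses at least \<open>n\<close> edges before it enters \<open>z\<close>, so by convexity of \<open>coth\<close> the mean
  duration is at least \<open>1 + n * coth (L / (2 * n))\<close>, where \<open>L\<close> is any upper bound for the mean drop of \<open>ln R\<close> up to
  the last edge. By concavity of the logarithm one can take \<open>L = ln (u x0 * B * s\<^sup>2 / (f x0)\<^sup>2)\<close>, where \<open>B\<close> is the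
  weight of \<open>z\<close>. These are the lemmas \<open>flow_potential_sum\<close>, \<open>log_ratio_drop_le\<close> and \<open>hit_src_deriv\<close>.

  In case (b) the bound \<open>u x0 \<le> r\<close> by the effective resistance follows from Dirichlet's principle, and
  \<open>u x0 * B \<le> g ^ n\<close>. In case (a) the number \<open>K\<close> of expected visits to \<open>x0\<close> appears in place of the resistance; if
  it is large, the traffic through the edges at \<open>x0\<close> alone makes the walk slow enough (\<open>steps_ge_source_weight\<close>).

  In both cases, with \<open>f x0 = s * h ^ n\<close>, the logarithmic derivative of \<open>h\<close> is at least
  \<open>(g + h\<^sup>2) / (g - h\<^sup>2)\<close>. Integrating from \<open>s\<close> to \<open>1\<close> gives \<open>(g + 1) * h \<le> s * (g + h\<^sup>2)\<close>
  (\<open>hit_src_subsolution\<close>). This says exactly that \<open>h\<close> to the power of the distance to \<open>n\<close> is a subsolution of the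
  one-step equation of the biased walk, whence its transform is at least \<open>h ^ n\<close> (\<open>laplace_ge_power\<close>), and the factor
  \<open>s\<close> is the additional unit of time.

  All sums over vertices are kept finite: the walk is killed when it leaves a finite set \<open>W\<close>. The equations for \<open>u\<close> and
  \<open>f\<close> and every estimate above survive the killing, and the transforms of the killed walks approximate that of \<open>T\<close>
  (\<open>laplace_le_hit\<close>). For \<open>s = 1\<close> the biased walk is recurrent or drifts to the right, and its transform is one; for
  \<open>n = 0\<close> the inequality only says that \<open>T \<ge> 1\<close>.
\<close>

section \<open>Tangent inequalities for the hyperbolic cotangent\<close>

text \<open>
  With \<open>A = exp l * B\<close> the quotient \<open>(A + B) / (A - B)\<close> is \<open>coth (l / 2)\<close>, and \<open>\<kappa> + c * ln G - c * l\<close> is its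
  tangent line at \<open>l = ln G\<close>; the inequality for \<open>\<delta> = 1\<close> is the convexity of \<open>coth\<close>. The tangent line rather than
  Jensen's inequality is used later because it is linear and can be summed over the edges of a flow against any
  function that changes by at most one along an edge; that change is \<open>\<delta>\<close>.
\<close>

lemma edge_inequality:
  fixes A B G \<delta> :: real
  assumes A: "0 < A" and B: "0 < B" and G: "1 < G" and \<delta>: "\<bar>\<delta>\<bar> \<le> 1"
  defines "\<kappa> \<equiv> (G + 1) / (G - 1)" and "c \<equiv> 2 * G / (G - 1)\<^sup>2"
  shows "(A - B) * ((\<kappa> + c * ln G) * \<delta> - c * (ln A - ln B)) \<le> A + B"
proof -
  have c: "0 < c" and \<kappa>: "0 < \<kappa>" using G by (auto simp: c_def \<kappa>_def)
  have C: "0 \<le> \<kappa> + c * ln G" using c \<kappa> G by simp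
  have main: "(t - 1) * (\<kappa> + c * ln G - c * ln t) \<le> t + 1" if t: "1 \<le> t" for t
  proof -
    have "ln (G / t) \<le> G / t - 1" using t G by (intro ln_le_minus_one) auto
    hence l: "1 - G / t \<le> ln t - ln G" using t G by (simp add: ln_div)
    have "(t - 1) * (\<kappa> + c * ln G - c * ln t) = (t - 1) * \<kappa> - (t - 1) * c * (ln t - ln G)"
      by (simp add: algebra_simps)
    also have "\<dots> \<le> (t - 1) * \<kappa> - (t - 1) * c * (1 - G / t)"
      using l t c by (intro diff_left_mono mult_left_mono) auto
    also have "\<dots> = (t + 1) - 2 * (t - G)\<^sup>2 / (t * (G - 1)\<^sup>2)"
      using t G unfolding \<kappa>_def c_def
      by (simp add: divide_simps power2_eq_square) (simp add: algebra_simps)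
    also have "\<dots> \<le> t + 1" using t by simp
    finally show ?thesis .
  qed
  have ordered: "(A - B) * ((\<kappa> + c * ln G) * \<delta> - c * (ln A - ln B)) \<le> A + B"
    if "0 < B" "B \<le> A" "\<delta> \<le> 1" for A B \<delta>
  proof -
    have "(A - B) * ((\<kappa> + c * ln G) * \<delta> - c * (ln A - ln B))
        \<le> (A - B) * ((\<kappa> + c * ln G) - c * (ln A - ln B))"
      using that C by (intro mult_left_mono diff_right_mono mult_left_le) auto
    also have "\<dots> = B * ((A / B - 1) * (\<kappa> + c * ln G - c * ln (A / B)))"
      using that by (simp add: ln_div field_simps)
    also have "\<dots> \<le> B * (A / B + 1)"
      using that by (intro mult_left_mono main) auto
    also have "\<dots> = A + B" using that by (simp add: field_simps)
    finally show ?thesis .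
  qed
  show ?thesis
  proof (cases "B \<le> A")
    case True
    thus ?thesis using ordered[of B A \<delta>] B \<delta> by auto
  next
    case False
    have "(B - A) * ((\<kappa> + c * ln G) * (- \<delta>) - c * (ln B - ln A)) \<le> B + A"
      using ordered[of A B "- \<delta>"] A False \<delta> by auto
    thus ?thesis by (simp add: algebra_simps)
  qed
qed

text \<open>
  The variant of the preceding inequality for edges at the source. There a part of the weight \<open>A\<close>, whose sum over
  these edges is the expected number of visits to the source, is given up in order to pay for the growth of the
  logarithm of that number. The constant comes from the tangent of the logarithm at \<open>B / A = c / (c + 1)\<close>.
\<close>

lemma source_edge_inequality:
  fixes A B c :: real
  assumes A: "0 < A" and B: "0 < B" and c: "0 < c"
  shows "(A - B) * (1 + c * ln ((c + 1) / c) - c * (ln A - ln B)) \<le> A + B - c / (c + 1) * A"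
proof (cases "B \<le> A")
  case True
  define \<rho> where "\<rho> = B / A"
  have \<rho>: "0 < \<rho>" "\<rho> \<le> 1" using A B True by (auto simp: \<rho>_def)
  have "ln (\<rho> * ((c + 1) / c)) \<le> \<rho> * ((c + 1) / c) - 1"
    using \<rho> c by (intro ln_le_minus_one) auto
  hence l: "ln \<rho> + ln ((c + 1) / c) \<le> \<rho> * ((c + 1) / c) - 1"
    using \<rho> c by (subst (asm) ln_mult) auto
  have "(1 - \<rho>) * (1 + c * ln ((c + 1) / c) + c * ln \<rho>)
      = (1 - \<rho>) * (1 + c * (ln \<rho> + ln ((c + 1) / c)))" by (simp add: algebra_simps)
  also have "\<dots> \<le> (1 - \<rho>) * (1 + c * (\<rho> * ((c + 1) / c) - 1))"
    using \<rho> c l by (intro mult_left_mono add_left_mono) auto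
  also have "\<dots> = 1 + \<rho> - c / (c + 1) - (((c + 1) * \<rho> - c)\<^sup>2 / (c + 1) + \<rho>)"
    using c by (simp add: divide_simps power2_eq_square) (simp add: algebra_simps)
  also have "\<dots> \<le> 1 + \<rho> - c / (c + 1)"
  proof -
    have "0 \<le> ((c + 1) * \<rho> - c)\<^sup>2 / (c + 1)" using c by simp
    thus ?thesis using \<rho> by linarith
  qed
  finally have "A * ((1 - \<rho>) * (1 + c * ln ((c + 1) / c) + c * ln \<rho>)) \<le> A * (1 + \<rho> - c / (c + 1))"
    using A by (intro mult_left_mono) auto
  moreover have "A * (1 - \<rho>) = A - B" using A by (simp add: \<rho>_def field_simps)
  moreover have "ln \<rho> = ln B - ln A" using A B by (simp add: \<rho>_def ln_div)
  moreover have "A * (1 + \<rho> - c / (c + 1)) = A + B - c / (c + 1) * A"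
    using A by (simp add: \<rho>_def algebra_simps)
  ultimately show ?thesis by (simp add: algebra_simps)
next
  case False
  have "0 \<le> 1 + c * ln ((c + 1) / c) - c * (ln A - ln B)"
  proof -
    have "0 \<le> c * ln ((c + 1) / c)" using c by simp
    moreover have "0 \<le> c * (ln B - ln A)" using False A B c by simp
    ultimately show ?thesis by (simp add: algebra_simps)
  qed
  hence "(A - B) * (1 + c * ln ((c + 1) / c) - c * (ln A - ln B)) \<le> 0"
    using False by (intro mult_nonpos_nonneg) auto
  also have "0 \<le> A + B - c / (c + 1) * A"
  proof -
    have "c / (c + 1) * A \<le> 1 * A" using A c by (intro mult_right_mono) auto
    thus ?thesis using B by simp
  qed
  finally show ?thesis .
qed

lemma weighted_ln_le:
  fixes q t :: "'a \<Rightarrow> real"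
  assumes fin: "finite I" and q: "\<And>i. i \<in> I \<Longrightarrow> 0 \<le> q i" and sum1: "(\<Sum>i\<in>I. q i) = 1"
    and t: "\<And>i. i \<in> I \<Longrightarrow> q i > 0 \<Longrightarrow> 0 < t i"
    and le: "(\<Sum>i\<in>I. q i * t i) \<le> \<tau>" and \<tau>: "0 < \<tau>"
  shows "(\<Sum>i\<in>I. q i * ln (t i)) \<le> ln \<tau>"
proof -
  have "(\<Sum>i\<in>I. q i * ln (t i)) \<le> (\<Sum>i\<in>I. q i * (ln \<tau> + (t i / \<tau> - 1)))"
  proof (intro sum_mono)
    fix i assume i: "i \<in> I"
    show "q i * ln (t i) \<le> q i * (ln \<tau> + (t i / \<tau> - 1))"
    proof (cases "q i > 0")
      case True
      have "ln (t i / \<tau>) \<le> t i / \<tau> - 1" using t[OF i True] \<tau> by (intro ln_le_minus_one) auto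
      thus ?thesis using t[OF i True] \<tau> True by (simp add: ln_div)
    qed (use q[OF i] in auto)
  qed
  also have "\<dots> = (ln \<tau> - 1) * (\<Sum>i\<in>I. q i) + (\<Sum>i\<in>I. q i * t i) / \<tau>"
    by (simp add: sum.distrib sum_subtractf sum_distrib_left sum_divide_distrib algebra_simps)
  also have "\<dots> \<le> (ln \<tau> - 1) * 1 + \<tau> / \<tau>" using sum1 le \<tau> by (intro add_mono divide_right_mono) auto
  also have "\<dots> = ln \<tau>" using \<tau> by simp
  finally show ?thesis .
qed

section \<open>The Wronskian flow of a finite killed network\<close>

text \<open>
  A walk on the finite set \<open>W\<close> which moves from \<open>x\<close> to \<open>y\<close> with probability \<open>w x y / wt x\<close>, reaches the target
  with probability \<open>b x / wt x\<close>, and dies with the remaining probability. Allowing the walk to die makes it possible to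
  cut an infinite graph down to a finite set of vertices without changing the weights of the vertices kept.
\<close>

locale killed_network =
  fixes W :: "'a set" and w :: "'a \<Rightarrow> 'a \<Rightarrow> real" and wt b :: "'a \<Rightarrow> real" and src :: 'a
  assumes finite_W: "finite W" and src_W: "src \<in> W"
    and w_sym: "\<And>x y. x \<in> W \<Longrightarrow> y \<in> W \<Longrightarrow> w x y = w y x"
    and w_nonneg: "\<And>x y. x \<in> W \<Longrightarrow> y \<in> W \<Longrightarrow> 0 \<le> w x y"
    and b_nonneg: "\<And>x. x \<in> W \<Longrightarrow> 0 \<le> b x"
    and wt_pos: "\<And>x. x \<in> W \<Longrightarrow> 0 < wt x"
    and total_le: "\<And>x. x \<in> W \<Longrightarrow> (\<Sum>y\<in>W. w x y) + b x \<le> wt x"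

text \<open>
  For \<open>u\<close> and \<open>f\<close> one should think of the Green function \<open>u x = (\<Sum>k. s ^ k * P(X\<^sub>k = x)) / wt x\<close> of the walk
  from \<open>src\<close>, and of \<open>f x\<close>, the expectation of \<open>s\<close> to the power of the time to the target from \<open>x\<close>. Weighting
  the law of the walk from \<open>src\<close> by \<open>s\<close> to the power of that time, and normalising, one obtains the tilted walk. Then
  \<open>s * w x y * u x * f y / f src\<close> is the expected number of its steps from \<open>x\<close> to \<open>y\<close>, so that \<open>flow\<close> and
  \<open>traffic\<close> below are the net and the total number of its passages through an edge, and \<open>exit_law\<close> is the law of
  the vertex from which it enters the target.
\<close>

locale tilted_flow = killed_network +
  fixes s :: real and u f :: "'a \<Rightarrow> real"
  assumes s_pos: "0 < s"
    and u_eq: "\<And>x. x \<in> W \<Longrightarrow> wt x * u x = (if x = src then 1 else 0) + s * (\<Sum>y\<in>W. w x y * u y)"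
    and f_eq: "\<And>x. x \<in> W \<Longrightarrow> wt x * f x = s * (b x + (\<Sum>y\<in>W. w x y * f y))"
    and u_nonneg: "\<And>x. x \<in> W \<Longrightarrow> 0 \<le> u x"
    and f_nonneg: "\<And>x. x \<in> W \<Longrightarrow> 0 \<le> f x"
    and f_le: "\<And>x. x \<in> W \<Longrightarrow> f x \<le> s"
    and positive_across_edges: "\<And>x y. x \<in> W \<Longrightarrow> y \<in> W \<Longrightarrow> 0 < w x y \<Longrightarrow> 0 < u x \<Longrightarrow>
       0 < u y \<and> 0 < f x \<and> 0 < f y"
    and f_src: "0 < f src"
begin

definition flow :: "'a \<Rightarrow> 'a \<Rightarrow> real" where
  "flow x y = s * w x y * (u x * f y - u y * f x) / f src"

definition traffic :: "'a \<Rightarrow> 'a \<Rightarrow> real" where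
  "traffic x y = s * w x y * (u x * f y + u y * f x) / f src"

definition exit_law :: "'a \<Rightarrow> real" where
  "exit_law x = s * b x * u x / f src"

definition log_ratio :: "'a \<Rightarrow> real" where
  "log_ratio x = ln (u x) - ln (f x)"

lemma u_src: "0 < u src"
proof -
  have "0 \<le> s * (\<Sum>y\<in>W. w src y * u y)"
    using s_pos src_W by (intro mult_nonneg_nonneg sum_nonneg) (auto intro: w_nonneg u_nonneg)
  hence "0 < wt src * u src" using u_eq[OF src_W] by simp
  thus ?thesis using wt_pos[OF src_W] by (simp add: zero_less_mult_iff)
qed

lemma flow_antisym: "x \<in> W \<Longrightarrow> y \<in> W \<Longrightarrow> flow y x = - flow x y"
  by (simp add: flow_def w_sym[of y x] algebra_simps add_divide_distrib diff_divide_distrib)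

text \<open>
  The flow is a discrete Wronskian of \<open>u\<close> and \<open>f\<close>. Both solve the same equation off the source and the target, so the
  flow is conserved there.
\<close>

lemma flow_divergence:
  assumes x: "x \<in> W"
  shows "(\<Sum>y\<in>W. flow x y) = (if x = src then 1 else 0) - exit_law x"
proof -
  have "f src * (\<Sum>y\<in>W. flow x y) = (\<Sum>y\<in>W. s * w x y * (u x * f y - u y * f x))"
    unfolding sum_distrib_left flow_def using f_src by (intro sum.cong) auto
  also have "\<dots> = u x * (s * (\<Sum>y\<in>W. w x y * f y)) - f x * (s * (\<Sum>y\<in>W. w x y * u y))"
    unfolding sum_distrib_left sum_subtractf[symmetric] by (intro sum.cong) (auto simp: algebra_simps)
  also have "\<dots> = u x * (wt x * f x - s * b x) - f x * (wt x * u x - (if x = src then 1 else 0))"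
    using u_eq[OF x] f_eq[OF x] by (simp add: algebra_simps)
  also have "\<dots> = (if x = src then f src else 0) - s * b x * u x"
    by (simp add: algebra_simps)
  finally show ?thesis
    using f_src by (simp add: exit_law_def field_simps split: if_splits)
qed

lemma sum_by_parts:
  "(\<Sum>x\<in>W. \<Sum>y\<in>W. flow x y * (\<psi> x - \<psi> y)) / 2 = \<psi> src - (\<Sum>x\<in>W. exit_law x * \<psi> x)"
proof -
  have "(\<Sum>x\<in>W. \<Sum>y\<in>W. flow x y * \<psi> y) = (\<Sum>y\<in>W. \<Sum>x\<in>W. flow x y * \<psi> y)"
    by (rule sum.swap)
  also have "\<dots> = (\<Sum>y\<in>W. \<Sum>x\<in>W. - (flow y x * \<psi> y))"
    by (intro sum.cong refl) (subst flow_antisym, auto)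
  finally have "(\<Sum>x\<in>W. \<Sum>y\<in>W. flow x y * (\<psi> x - \<psi> y)) / 2 = (\<Sum>x\<in>W. \<Sum>y\<in>W. flow x y * \<psi> x)"
    by (simp add: right_diff_distrib sum_subtractf sum_negf)
  also have "\<dots> = (\<Sum>x\<in>W. ((if x = src then 1 else 0) - exit_law x) * \<psi> x)"
    by (intro sum.cong refl) (simp add: sum_distrib_right[symmetric] flow_divergence)
  also have "\<dots> = (\<Sum>x\<in>W. if x = src then \<psi> src else 0) - (\<Sum>x\<in>W. exit_law x * \<psi> x)"
    unfolding sum_subtractf[symmetric] by (intro sum.cong) (auto simp: algebra_simps)
  also have "(\<Sum>x\<in>W. if x = src then \<psi> src else 0) = \<psi> src"
    using finite_W src_W by simp
  finally show ?thesis .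
qed

lemma exit_law_sum: "(\<Sum>x\<in>W. exit_law x) = 1"
  using sum_by_parts[of "\<lambda>_. 1"] by simp

lemma exit_law_nonneg: "x \<in> W \<Longrightarrow> 0 \<le> exit_law x"
  using s_pos f_src b_nonneg u_nonneg by (simp add: exit_law_def)

text \<open>
  By concavity of the logarithm the mean drop of \<open>ln (u / f)\<close> from the source to the exit vertex is at most the logarithm of the mean of the ratio
  \<open>u src * f x / (f src * u x)\<close> at the exit vertex \<open>x\<close>. In this mean \<open>u x\<close> cancels against the exit law, and what is
  left is the total conductance into the target.
\<close>

lemma log_ratio_drop_le:
  assumes B: "(\<Sum>x\<in>W. b x) \<le> B"
  shows "log_ratio src - (\<Sum>x\<in>W. exit_law x * log_ratio x) \<le> ln (u src * B * s\<^sup>2 / (f src)\<^sup>2)"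
proof -
  let ?t = "\<lambda>x. u src * f x / (f src * u x)"
  have pos: "0 < u x \<and> 0 < f x \<and> 0 < b x" if x: "x \<in> W" and q: "0 < exit_law x" for x
  proof -
    have "0 < b x * u x" using q s_pos f_src by (simp add: exit_law_def zero_less_divide_iff zero_less_mult_iff mult.assoc)
    hence ub: "0 < b x" "0 < u x" using b_nonneg[OF x] u_nonneg[OF x] by (auto simp: zero_less_mult_iff)
    have "0 \<le> (\<Sum>y\<in>W. w x y * f y)" using x by (intro sum_nonneg mult_nonneg_nonneg) (auto intro: w_nonneg f_nonneg)
    hence "0 < wt x * f x" using f_eq[OF x] ub s_pos by simp
    thus ?thesis using ub wt_pos[OF x] by (simp add: zero_less_mult_iff)
  qed
  have tpos: "0 < ?t x" if "x \<in> W" "0 < exit_law x" for x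
    using pos[OF that] u_src f_src by simp
  have "\<exists>x\<in>W. 0 < exit_law x"
  proof (rule ccontr)
    assume "\<not> ?thesis"
    hence "(\<Sum>x\<in>W. exit_law x) \<le> 0" by (intro sum_nonpos) auto
    thus False using exit_law_sum by simp
  qed
  then obtain x0 where x0: "x0 \<in> W" "0 < exit_law x0" by blast
  have "b x0 \<le> (\<Sum>x\<in>W. b x)" using finite_W x0 b_nonneg by (intro member_le_sum) auto
  hence Bpos: "0 < B" using pos[OF x0] B by linarith
  have "log_ratio src - (\<Sum>x\<in>W. exit_law x * log_ratio x)
      = (\<Sum>x\<in>W. exit_law x * (log_ratio src - log_ratio x))"
    using exit_law_sum by (simp add: right_diff_distrib sum_subtractf sum_distrib_right[symmetric])
  also have "\<dots> = (\<Sum>x\<in>W. exit_law x * ln (?t x))"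
  proof (intro sum.cong refl)
    fix x assume x: "x \<in> W"
    show "exit_law x * (log_ratio src - log_ratio x) = exit_law x * ln (?t x)"
    proof (cases "0 < exit_law x")
      case True
      thus ?thesis using pos[OF x True] u_src f_src
        by (simp add: log_ratio_def ln_div ln_mult)
    qed (use exit_law_nonneg[OF x] in simp)
  qed
  also have "\<dots> \<le> ln (u src * B * s\<^sup>2 / (f src)\<^sup>2)"
  proof (rule weighted_ln_le[OF finite_W exit_law_nonneg exit_law_sum tpos])
    have "(\<Sum>x\<in>W. exit_law x * ?t x) \<le> (\<Sum>x\<in>W. b x * (u src * s\<^sup>2 / (f src)\<^sup>2))"
    proof (intro sum_mono)
      fix x assume x: "x \<in> W"
      show "exit_law x * ?t x \<le> b x * (u src * s\<^sup>2 / (f src)\<^sup>2)"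
      proof (cases "0 < exit_law x")
        case True
        \<comment> \<open>One factor \<open>s\<close> comes from the last step, and one from \<open>f x \<le> s\<close> before it.\<close>
        have "exit_law x * ?t x = b x * (u src * (s * f x) / (f src)\<^sup>2)"
          using pos[OF x True] f_src by (simp add: exit_law_def power2_eq_square)
        also have "\<dots> \<le> b x * (u src * (s * s) / (f src)\<^sup>2)"
          using b_nonneg[OF x] u_src s_pos f_le[OF x]
          by (intro mult_left_mono divide_right_mono) auto
        finally show ?thesis by (simp add: power2_eq_square)
      next
        case False
        hence "exit_law x = 0" using exit_law_nonneg[OF x] by simp
        thus ?thesis using b_nonneg[OF x] u_src by simp
      qed
    qed
    also have "\<dots> = (\<Sum>x\<in>W. b x) * (u src * s\<^sup>2 / (f src)\<^sup>2)" by (rule sum_distrib_right[symmetric])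
    also have "\<dots> \<le> B * (u src * s\<^sup>2 / (f src)\<^sup>2)" using B u_src by (intro mult_right_mono) auto
    finally show "(\<Sum>x\<in>W. exit_law x * ?t x) \<le> u src * B * s\<^sup>2 / (f src)\<^sup>2" by (simp add: mult_ac)
    show "0 < u src * B * s\<^sup>2 / (f src)\<^sup>2" using u_src Bpos s_pos f_src by simp
  qed
  finally show ?thesis .
qed

lemma steps_eq_traffic:
  "s * (\<Sum>x\<in>W. \<Sum>y\<in>W. w x y * u x * f y) / f src = (\<Sum>x\<in>W. \<Sum>y\<in>W. traffic x y) / 2"
proof -
  let ?S = "\<Sum>x\<in>W. \<Sum>y\<in>W. w x y * u x * f y"
  have "?S = (\<Sum>x\<in>W. \<Sum>y\<in>W. w x y * u y * f x)"
    by (subst sum.swap) (intro sum.cong refl, auto simp: w_sym)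
  hence "?S + ?S = ?S + (\<Sum>x\<in>W. \<Sum>y\<in>W. w x y * u y * f x)" by simp
  also have "\<dots> = (\<Sum>x\<in>W. \<Sum>y\<in>W. w x y * (u x * f y + u y * f x))"
    by (simp add: sum.distrib[symmetric] algebra_simps)
  finally have P: "(\<Sum>x\<in>W. \<Sum>y\<in>W. w x y * (u x * f y + u y * f x)) = 2 * ?S" by simp
  have "(\<Sum>x\<in>W. \<Sum>y\<in>W. traffic x y) = s * (\<Sum>x\<in>W. \<Sum>y\<in>W. w x y * (u x * f y + u y * f x)) / f src"
    by (simp add: traffic_def sum_distrib_left sum_divide_distrib mult.assoc)
  thus ?thesis unfolding P by simp
qed

text \<open>In what follows \<open>d\<close> stands for the graph distance to the source, cut off at \<open>n\<close>.\<close>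

context
  fixes d :: "'a \<Rightarrow> real" and n :: nat and G :: real
  assumes d_src: "d src = 0"
    and d_lipschitz: "\<And>x y. x \<in> W \<Longrightarrow> y \<in> W \<Longrightarrow> 0 < w x y \<Longrightarrow> \<bar>d y - d x\<bar> \<le> 1"
    and d_exit: "\<And>x. x \<in> W \<Longrightarrow> 0 < b x \<Longrightarrow> d x = real n"
    and G: "1 < G"
begin

text \<open>
  Along the unit flow \<open>d\<close> increases by \<open>n\<close> on average, which here replaces the statement that every path from the source
  to the target has at least \<open>n\<close> edges before the last one.
\<close>

lemma flow_potential_sum:
  "(\<Sum>x\<in>W. \<Sum>y\<in>W. flow x y * (C * (d y - d x) - c * (log_ratio x - log_ratio y))) / 2
    = real n * C - c * (log_ratio src - (\<Sum>x\<in>W. exit_law x * log_ratio x))"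
proof -
  have "(\<Sum>x\<in>W. exit_law x * d x) = (\<Sum>x\<in>W. exit_law x * real n)"
  proof (intro sum.cong refl)
    fix x assume x: "x \<in> W"
    show "exit_law x * d x = exit_law x * real n"
      using d_exit[OF x] b_nonneg[OF x] by (cases "b x = 0") (auto simp: exit_law_def)
  qed
  also have "\<dots> = real n" using exit_law_sum by (simp add: sum_distrib_right[symmetric])
  finally have d: "(\<Sum>x\<in>W. exit_law x * d x) = real n" .
  define \<psi> where "\<psi> x = - (C * d x) - c * log_ratio x" for x
  have "(\<Sum>x\<in>W. \<Sum>y\<in>W. flow x y * (C * (d y - d x) - c * (log_ratio x - log_ratio y))) / 2
      = (\<Sum>x\<in>W. \<Sum>y\<in>W. flow x y * (\<psi> x - \<psi> y)) / 2"
    by (simp add: \<psi>_def algebra_simps)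
  also have "\<dots> = \<psi> src - (\<Sum>x\<in>W. exit_law x * \<psi> x)" by (rule sum_by_parts)
  also have "(\<Sum>x\<in>W. exit_law x * \<psi> x)
      = - (C * (\<Sum>x\<in>W. exit_law x * d x)) - c * (\<Sum>x\<in>W. exit_law x * log_ratio x)"
    by (simp add: \<psi>_def right_diff_distrib sum_subtractf sum_negf sum_distrib_left mult_ac)
  finally show ?thesis unfolding d by (simp add: \<psi>_def d_src algebra_simps)
qed

text \<open>
  Only edges with traffic matter, and on these \<open>u\<close> and \<open>f\<close> are positive at both ends, so that the logarithms have
  their usual meaning.
\<close>

lemma edge_cases:
  assumes "x \<in> W" "y \<in> W"
  obtains "flow x y = 0" "traffic x y = 0" "s * w x y * (u x * f y) / f src = 0"
  | "0 < w x y" "0 < u x * f y" "0 < u y * f x"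
    "ln (u x * f y) - ln (u y * f x) = log_ratio x - log_ratio y"
proof (cases "0 < w x y \<and> (0 < u x \<or> 0 < u y)")
  case True
  have "0 < w y x" using True w_sym[OF assms] by simp
  hence "0 < u x" "0 < u y" "0 < f x" "0 < f y"
    using True positive_across_edges[OF assms] positive_across_edges[OF assms(2,1)] by auto
  thus ?thesis using True that(2) by (simp add: ln_mult log_ratio_def)
next
  case False
  hence "w x y = 0 \<or> u x = 0 \<and> u y = 0"
    using w_nonneg[OF assms] u_nonneg[OF assms(1)] u_nonneg[OF assms(2)] by linarith
  thus ?thesis using that(1) by (auto simp: flow_def traffic_def)
qed

lemma traffic_ge:
  assumes "x \<in> W" "y \<in> W"
  shows "flow x y * (((G + 1) / (G - 1) + 2 * G / (G - 1)\<^sup>2 * ln G) * (d y - d x)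
            - 2 * G / (G - 1)\<^sup>2 * (log_ratio x - log_ratio y)) \<le> traffic x y"
  using assms
proof (cases rule: edge_cases)
  case 2
  let ?F = "(((G + 1) / (G - 1) + 2 * G / (G - 1)\<^sup>2 * ln G) * (d y - d x)
            - 2 * G / (G - 1)\<^sup>2 * (log_ratio x - log_ratio y))"
  have "(u x * f y - u y * f x) * ?F \<le> u x * f y + u y * f x"
    using edge_inequality[OF 2(2,3) G d_lipschitz[OF assms 2(1)]] 2(4) by simp
  hence "s * w x y / f src * ((u x * f y - u y * f x) * ?F) \<le> s * w x y / f src * (u x * f y + u y * f x)"
    using s_pos 2 f_src by (intro mult_left_mono) auto
  thus ?thesis by (simp add: flow_def traffic_def)
qed auto

text \<open>
  The tilted walk makes at least \<open>n * (G + 1) / (G - 1)\<close> steps on average before the last one, which is the number of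
  steps that a walk on the line with bias \<open>G\<close> needs for a distance \<open>n\<close>. Summing the tangent inequality over all edges
  leaves the mean drop of \<open>ln (u / f)\<close>, which is at most \<open>n * ln G\<close> under the hypothesis on \<open>u src\<close>.
\<close>

lemma steps_ge_resistance:
  assumes B: "(\<Sum>x\<in>W. b x) \<le> B" and rB: "u src * B * s\<^sup>2 / (f src)\<^sup>2 \<le> G ^ n" and B0: "0 < B"
  shows "real n * (G + 1) / (G - 1) * f src \<le> s * (\<Sum>x\<in>W. \<Sum>y\<in>W. w x y * u x * f y)"
proof -
  define c where "c = 2 * G / (G - 1)\<^sup>2"
  define C where "C = (G + 1) / (G - 1) + c * ln G"
  have c: "0 < c" using G by (simp add: c_def)
  have "real n * C - c * (log_ratio src - (\<Sum>x\<in>W. exit_law x * log_ratio x))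
      = (\<Sum>x\<in>W. \<Sum>y\<in>W. flow x y * (C * (d y - d x) - c * (log_ratio x - log_ratio y))) / 2"
    by (simp only: flow_potential_sum)
  also have "\<dots> \<le> (\<Sum>x\<in>W. \<Sum>y\<in>W. traffic x y) / 2"
    using traffic_ge by (intro divide_right_mono sum_mono) (auto simp: C_def c_def)
  finally have 1: "real n * C - c * (log_ratio src - (\<Sum>x\<in>W. exit_law x * log_ratio x))
      \<le> (\<Sum>x\<in>W. \<Sum>y\<in>W. traffic x y) / 2" .
  have "log_ratio src - (\<Sum>x\<in>W. exit_law x * log_ratio x) \<le> ln (u src * B * s\<^sup>2 / (f src)\<^sup>2)"
    by (rule log_ratio_drop_le[OF B])
  also have "\<dots> \<le> ln (G ^ n)"
    using rB u_src B0 s_pos f_src G by (subst ln_le_cancel_iff) auto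
  also have "\<dots> = real n * ln G" using G by (simp add: ln_realpow)
  finally have "c * (log_ratio src - (\<Sum>x\<in>W. exit_law x * log_ratio x)) \<le> c * (real n * ln G)"
    using c by (intro mult_left_mono) auto
  with 1 have "real n * ((G + 1) / (G - 1)) \<le> (\<Sum>x\<in>W. \<Sum>y\<in>W. traffic x y) / 2"
    by (simp add: C_def algebra_simps)
  hence "real n * ((G + 1) / (G - 1)) \<le> s * (\<Sum>x\<in>W. \<Sum>y\<in>W. w x y * u x * f y) / f src"
    by (simp add: steps_eq_traffic)
  thus ?thesis using f_src by (simp add: pos_le_divide_eq)
qed

text \<open>
  The same conclusion if \<open>u src\<close> is not controlled. The mean drop of \<open>ln (u / f)\<close> now contains \<open>ln K\<close>, where
  \<open>K = wt src * u src\<close> is the expected number of visits to the source. If \<open>K\<close> is large this term would spoil the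
  estimate, but then the visits to the source already cost \<open>K\<close> steps. The linear bound for \<open>ln K\<close> at \<open>c + 1\<close> has
  slope \<open>1 / (c + 1)\<close>, and \<open>source_edge_inequality\<close> saves \<open>c / (c + 1) * K\<close> on the edges at the source, which
  cancels \<open>c * ln K\<close> up to a constant.
\<close>

lemma steps_ge_source_weight:
  assumes B: "(\<Sum>x\<in>W. b x) \<le> B" and B0: "0 < B" and n: "1 \<le> n"
    and d_first: "\<And>y. y \<in> W \<Longrightarrow> 0 < w src y \<Longrightarrow> y \<noteq> src \<Longrightarrow> d y = 1"
    and b_src: "b src = 0"
    and rB: "2 * (B / wt src * s\<^sup>2 / (f src)\<^sup>2) \<le> G ^ n * (1 - 1 / G)\<^sup>2"
  shows "real n * (G + 1) / (G - 1) * f src \<le> s * (\<Sum>x\<in>W. \<Sum>y\<in>W. w x y * u x * f y)"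
proof -
  define c where "c = 2 * G / (G - 1)\<^sup>2"
  define \<kappa> where "\<kappa> = (G + 1) / (G - 1)"
  define C where "C = \<kappa> + c * ln G"
  define C1 where "C1 = 1 + c * ln ((c + 1) / c)"
  define K where "K = wt src * u src"
  define out where "out y = s * w src y * (u src * f y) / f src" for y
  define F where "F x y = flow x y * (C * (d y - d x) - c * (log_ratio x - log_ratio y))" for x y
  have c: "0 < c" using G by (simp add: c_def)
  have K0: "0 < K" using wt_pos[OF src_W] u_src by (simp add: K_def)
  have F_le: "F x y \<le> traffic x y" if "x \<in> W" "y \<in> W" for x y
    using traffic_ge[OF that] by (simp add: F_def C_def c_def \<kappa>_def)
  have F_sym: "F y x = F x y" if "x \<in> W" "y \<in> W" for x y
    using flow_antisym[OF that] by (simp add: F_def algebra_simps)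
  have traffic_sym: "traffic y x = traffic x y" if "x \<in> W" "y \<in> W" for x y
    using w_sym[OF that] by (simp add: traffic_def algebra_simps)
  have first: "F src y + (C1 - C) * flow src y + c / (c + 1) * out y \<le> traffic src y"
    if y: "y \<in> W" "y \<noteq> src" for y
    using src_W y(1)
  proof (cases rule: edge_cases)
    case 1
    have "out y = 0" using 1(3) unfolding out_def .
    thus ?thesis using 1 by (simp add: F_def)
  next
    case 2
    have d: "d y - d src = 1" using d_first[OF y(1) 2(1) y(2)] d_src by simp
    have "(u src * f y - u y * f src) * (C1 - c * (log_ratio src - log_ratio y))
      \<le> u src * f y + u y * f src - c / (c + 1) * (u src * f y)"
      using source_edge_inequality[OF 2(2,3) c] 2(4) by (simp add: C1_def)
    hence "s * w src y / f src * ((u src * f y - u y * f src) * (C1 - c * (log_ratio src - log_ratio y)))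
      \<le> s * w src y / f src * (u src * f y + u y * f src - c / (c + 1) * (u src * f y))"
      using s_pos 2 f_src by (intro mult_left_mono) auto
    moreover have "flow src y = s * w src y / f src * (u src * f y - u y * f src)"
      "traffic src y = s * w src y / f src * (u src * f y + u y * f src)"
      "out y = s * w src y / f src * (u src * f y)"
      by (simp_all add: flow_def traffic_def out_def)
    ultimately have "flow src y * (C1 - c * (log_ratio src - log_ratio y)) \<le> traffic src y - c / (c + 1) * out y"
      by (simp only: right_diff_distrib mult_ac)
    thus ?thesis by (simp add: F_def d algebra_simps)
  qed
  \<comment> \<open>A loop at the source carries no flow and is counted once in half the sum of the traffic.\<close>
  have loop: "c / (c + 1) * out src \<le> traffic src src / 2"
  proof -
    have "0 \<le> out src" using s_pos f_src u_src src_W w_nonneg by (simp add: out_def)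
    hence "c / (c + 1) * out src \<le> 1 * out src"
      using c by (intro mult_right_mono) auto
    moreover have "traffic src src = 2 * out src" by (simp add: out_def traffic_def)
    ultimately show ?thesis by simp
  qed
  have flow_loop: "flow src src = 0" "F src src = 0" by (simp_all add: flow_def F_def)
  let ?W' = "W - {src}"
  have split: "(\<Sum>x\<in>W. \<Sum>y\<in>W. h x y)
      = h src src + 2 * (\<Sum>y\<in>?W'. h src y) + (\<Sum>x\<in>?W'. \<Sum>y\<in>?W'. h x y)"
    if "\<And>x y. x \<in> W \<Longrightarrow> y \<in> W \<Longrightarrow> h y x = h x y" for h :: "'a \<Rightarrow> 'a \<Rightarrow> real"
  proof -
    have 1: "(\<Sum>y\<in>W. k y) = k src + (\<Sum>y\<in>?W'. k y)" for k :: "'a \<Rightarrow> real"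
      using sum.remove[OF finite_W src_W] .
    have "(\<Sum>x\<in>?W'. h x src) = (\<Sum>x\<in>?W'. h src x)"
      using that src_W by (intro sum.cong) auto
    thus ?thesis by (simp add: 1 sum.distrib)
  qed
  have out_sum: "(\<Sum>y\<in>?W'. out y) + out src = K"
  proof -
    have "(\<Sum>y\<in>?W'. out y) + out src = (\<Sum>y\<in>W. out y)"
      using sum.remove[OF finite_W src_W, of out] by simp
    also have "\<dots> = u src / f src * (s * (\<Sum>y\<in>W. w src y * f y))"
      by (simp add: out_def sum_distrib_left mult_ac)
    also have "\<dots> = u src / f src * (wt src * f src)" using f_eq[OF src_W] b_src by simp
    also have "\<dots> = K" using f_src by (simp add: K_def)
    finally show ?thesis .
  qed
  have flow_sum: "(\<Sum>y\<in>?W'. flow src y) = 1"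
    using sum.remove[OF finite_W src_W, of "flow src"] flow_divergence[OF src_W] b_src
    by (simp add: flow_loop exit_law_def)
  have "(\<Sum>x\<in>W. \<Sum>y\<in>W. F x y) / 2 + (C1 - C) + c / (c + 1) * K
     = (\<Sum>y\<in>?W'. F src y + (C1 - C) * flow src y + c / (c + 1) * out y)
        + c / (c + 1) * out src + (\<Sum>x\<in>?W'. \<Sum>y\<in>?W'. F x y) / 2"
  proof -
    have "(\<Sum>y\<in>?W'. F src y + (C1 - C) * flow src y + c / (c + 1) * out y)
        = (\<Sum>y\<in>?W'. F src y) + (C1 - C) * (\<Sum>y\<in>?W'. flow src y) + c / (c + 1) * (\<Sum>y\<in>?W'. out y)"
      by (simp only: sum.distrib sum_distrib_left)
    moreover have "(\<Sum>x\<in>W. \<Sum>y\<in>W. F x y)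
        = F src src + 2 * (\<Sum>y\<in>?W'. F src y) + (\<Sum>x\<in>?W'. \<Sum>y\<in>?W'. F x y)"
      by (rule split) (rule F_sym)
    ultimately show ?thesis
      unfolding out_sum[symmetric] flow_sum flow_loop
      by (simp add: distrib_left add_divide_distrib)
  qed
  also have "\<dots> \<le> (\<Sum>y\<in>?W'. traffic src y) + traffic src src / 2 + (\<Sum>x\<in>?W'. \<Sum>y\<in>?W'. traffic x y) / 2"
    using loop by (intro add_mono sum_mono divide_right_mono first F_le) auto
  also have "\<dots> = (\<Sum>x\<in>W. \<Sum>y\<in>W. traffic x y) / 2"
    by (simp add: split[of traffic, OF traffic_sym] add_divide_distrib)
  finally have 1: "(\<Sum>x\<in>W. \<Sum>y\<in>W. F x y) / 2 + (C1 - C) + c / (c + 1) * K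
      \<le> (\<Sum>x\<in>W. \<Sum>y\<in>W. traffic x y) / 2" .
  have FF: "(\<Sum>x\<in>W. \<Sum>y\<in>W. F x y) / 2
      = real n * C - c * (log_ratio src - (\<Sum>x\<in>W. exit_law x * log_ratio x))"
    unfolding F_def by (rule flow_potential_sum)
  define X where "X = B / wt src * s\<^sup>2 / (f src)\<^sup>2"
  have X0: "0 < X" using B0 wt_pos[OF src_W] s_pos f_src by (simp add: X_def)
  have "log_ratio src - (\<Sum>x\<in>W. exit_law x * log_ratio x) \<le> ln (u src * B * s\<^sup>2 / (f src)\<^sup>2)"
    by (rule log_ratio_drop_le[OF B])
  also have "u src * B * s\<^sup>2 / (f src)\<^sup>2 = K * X"
    using wt_pos[OF src_W] by (simp add: K_def X_def)
  also have "ln (K * X) = ln K + ln X" using K0 X0 by (simp add: ln_mult)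
  also have "ln K \<le> ln (c + 1) + (K / (c + 1) - 1)"
    using ln_le_minus_one[of "K / (c + 1)"] K0 c by (simp add: ln_div)
  finally have "c * (log_ratio src - (\<Sum>x\<in>W. exit_law x * log_ratio x))
      \<le> c * (ln (c + 1) + (K / (c + 1) - 1) + ln X)"
    using c by (intro mult_left_mono) auto
  hence "real n * C - c * (ln (c + 1) + (K / (c + 1) - 1) + ln X) + (C1 - C) + c / (c + 1) * K
      \<le> (\<Sum>x\<in>W. \<Sum>y\<in>W. traffic x y) / 2"
    using 1 FF by linarith
  moreover have "C1 = 1 + c * ln (c + 1) - c * ln c"
    using c by (simp add: C1_def ln_div algebra_simps)
  ultimately have 2: "(real n - 1) * C + 1 + c - c * (ln c + ln X) \<le> (\<Sum>x\<in>W. \<Sum>y\<in>W. traffic x y) / 2"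
    by (simp add: algebra_simps)
  have "c * X \<le> G ^ (n - 1)"
  proof -
    have "c * X = G / (G - 1)\<^sup>2 * (2 * X)" by (simp add: c_def)
    also have "\<dots> \<le> G / (G - 1)\<^sup>2 * (G ^ n * (1 - 1 / G)\<^sup>2)"
      using rB G by (intro mult_left_mono) (auto simp: X_def)
    also have "\<dots> = G ^ n / G"
    proof -
      have "1 - 1 / G = (G - 1) / G" using G by (simp add: diff_divide_distrib)
      hence "(1 - 1 / G)\<^sup>2 = (G - 1)\<^sup>2 / G\<^sup>2" by (simp add: power_divide)
      thus ?thesis using G by (simp add: power2_eq_square)
    qed
    also have "\<dots> = G ^ (n - 1)" using n G by (cases n) auto
    finally show ?thesis .
  qed
  hence "ln (c * X) \<le> ln (G ^ (n - 1))" using c X0 G by (subst ln_le_cancel_iff) auto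
  hence "ln c + ln X \<le> (real n - 1) * ln G"
    using c X0 G n by (simp add: ln_mult ln_realpow)
  hence "c * (ln c + ln X) \<le> c * ((real n - 1) * ln G)" using c by (intro mult_left_mono) auto
  with 2 have 3: "(real n - 1) * \<kappa> + 1 + c \<le> (\<Sum>x\<in>W. \<Sum>y\<in>W. traffic x y) / 2"
    by (simp add: C_def algebra_simps)
  have "\<kappa> \<le> 1 + c"
  proof -
    have "1 + c - \<kappa> = 2 / (G - 1)\<^sup>2"
      using G by (simp add: c_def \<kappa>_def power2_eq_square divide_simps) (simp add: algebra_simps)
    moreover have "0 \<le> 2 / (G - 1)\<^sup>2" by simp
    ultimately show ?thesis by linarith
  qed
  with 3 have "real n * \<kappa> \<le> (\<Sum>x\<in>W. \<Sum>y\<in>W. traffic x y) / 2"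
    by (simp add: algebra_simps)
  hence "real n * \<kappa> \<le> s * (\<Sum>x\<in>W. \<Sum>y\<in>W. w x y * u x * f y) / f src"
    unfolding steps_eq_traffic .
  thus ?thesis using f_src by (simp add: \<kappa>_def pos_le_divide_eq)
qed

end
end

section \<open>Green function and hitting transform\<close>

text \<open>
  Green function and hitting transform are Neumann series of the substochastic matrix \<open>w x y / wt x\<close>; as power series in
  \<open>s\<close> they are differentiable, and their terms have a probabilistic meaning.
\<close>

context killed_network
begin

primrec iterate :: "('a \<Rightarrow> real) \<Rightarrow> nat \<Rightarrow> 'a \<Rightarrow> real" where
  "iterate \<psi> 0 = \<psi>"
| "iterate \<psi> (Suc k) = (\<lambda>x. (\<Sum>y\<in>W. w x y * iterate \<psi> k y) / wt x)"

definition neumann :: "('a \<Rightarrow> real) \<Rightarrow> real \<Rightarrow> 'a \<Rightarrow> real" where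
  "neumann \<psi> s x = (\<Sum>k. iterate \<psi> k x * s ^ k)"

definition green :: "real \<Rightarrow> 'a \<Rightarrow> real" where
  "green s = neumann (\<lambda>x. (if x = src then 1 else 0) / wt x) s"

definition hit :: "real \<Rightarrow> 'a \<Rightarrow> real" where
  "hit s x = s * neumann (\<lambda>x. b x / wt x) s x"

lemma sum_w_le: "x \<in> W \<Longrightarrow> (\<Sum>y\<in>W. w x y) \<le> wt x"
  using total_le[of x] b_nonneg[of x] by simp

lemma iterate_bounded:
  assumes "x \<in> W"
  shows "\<bar>iterate \<psi> k x\<bar> \<le> (\<Sum>y\<in>W. \<bar>\<psi> y\<bar>)"
  using assms
proof (induction k arbitrary: x)
  case 0
  thus ?case using finite_W by (auto intro: member_le_sum)
next
  case (Suc k)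
  have "\<bar>\<Sum>y\<in>W. w x y * iterate \<psi> k y\<bar> \<le> (\<Sum>y\<in>W. w x y * (\<Sum>y\<in>W. \<bar>\<psi> y\<bar>))"
    using Suc w_nonneg by (intro order.trans[OF sum_abs] sum_mono) (auto simp: abs_mult intro!: mult_mono)
  also have "\<dots> \<le> wt x * (\<Sum>y\<in>W. \<bar>\<psi> y\<bar>)"
    unfolding sum_distrib_right[symmetric] using sum_w_le[OF Suc.prems]
    by (intro mult_right_mono sum_nonneg) auto
  finally show ?case using wt_pos[OF Suc.prems] by (simp add: abs_div pos_divide_le_eq mult.commute)
qed

lemma iterate_nonneg:
  assumes "\<And>x. x \<in> W \<Longrightarrow> 0 \<le> \<psi> x" "x \<in> W"
  shows "0 \<le> iterate \<psi> k x"
  using assms(2)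
proof (induction k arbitrary: x)
  case (Suc k)
  thus ?case using w_nonneg wt_pos[OF Suc.prems] by (auto intro!: divide_nonneg_pos sum_nonneg)
qed (use assms in auto)

lemma neumann_summable:
  assumes "x \<in> W" "\<bar>s\<bar> < 1"
  shows "summable (\<lambda>k. iterate \<psi> k x * s ^ k)"
proof (rule summable_comparison_test')
  show "summable (\<lambda>k. (\<Sum>y\<in>W. \<bar>\<psi> y\<bar>) * \<bar>s\<bar> ^ k)"
    using assms by (intro summable_mult summable_geometric) auto
  show "norm (iterate \<psi> k x * s ^ k) \<le> (\<Sum>y\<in>W. \<bar>\<psi> y\<bar>) * \<bar>s\<bar> ^ k" if "0 \<le> k" for k
    using iterate_bounded[OF assms(1), of \<psi> k]
    by (simp add: abs_mult power_abs mult_right_mono)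
qed

lemma neumann_eq:
  assumes x: "x \<in> W" and s: "\<bar>s\<bar> < 1"
  shows "wt x * neumann \<psi> s x = wt x * \<psi> x + s * (\<Sum>y\<in>W. w x y * neumann \<psi> s y)"
proof -
  have "wt x * neumann \<psi> s x = wt x * (\<psi> x + (\<Sum>k. iterate \<psi> (Suc k) x * s ^ Suc k))"
    using suminf_split_head[OF neumann_summable[OF x s, of \<psi>]] by (simp add: neumann_def)
  also have "(\<Sum>k. iterate \<psi> (Suc k) x * s ^ Suc k)
      = (\<Sum>k. \<Sum>y\<in>W. s * w x y / wt x * (iterate \<psi> k y * s ^ k))"
    by (simp add: sum_distrib_left sum_distrib_right sum_divide_distrib mult_ac)
  also have "\<dots> = (\<Sum>y\<in>W. \<Sum>k. s * w x y / wt x * (iterate \<psi> k y * s ^ k))"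
    by (rule suminf_sum) (intro summable_mult neumann_summable s)
  also have "\<dots> = (\<Sum>y\<in>W. s * w x y / wt x * neumann \<psi> s y)"
    unfolding neumann_def by (intro sum.cong refl suminf_mult neumann_summable s)
  finally show ?thesis
    using wt_pos[OF x] by (simp add: distrib_left sum_distrib_left mult_ac)
qed

lemma neumann_nonneg:
  assumes "\<And>x. x \<in> W \<Longrightarrow> 0 \<le> \<psi> x" "x \<in> W" "0 \<le> s" "s < 1"
  shows "0 \<le> neumann \<psi> s x"
  unfolding neumann_def using assms
  by (intro suminf_nonneg neumann_summable mult_nonneg_nonneg iterate_nonneg) auto

lemma neumann_pos_iff:
  assumes "\<And>x. x \<in> W \<Longrightarrow> 0 \<le> \<psi> x" "x \<in> W" "0 < s" "s < 1"
  shows "0 < neumann \<psi> s x \<longleftrightarrow> (\<exists>k. 0 < iterate \<psi> k x)"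
proof -
  have "0 \<le> iterate \<psi> k x * s ^ k" for k using iterate_nonneg[OF assms(1,2)] assms(3) by simp
  hence "0 < neumann \<psi> s x \<longleftrightarrow> (\<exists>k. 0 < iterate \<psi> k x * s ^ k)"
    unfolding neumann_def using assms by (intro suminf_pos_iff neumann_summable) auto
  thus ?thesis using assms by (simp add: zero_less_mult_iff)
qed

lemma neumann_differentiable:
  assumes x: "x \<in> W" and s: "\<bar>s\<bar> < 1"
  shows "(\<lambda>s. neumann \<psi> s x) field_differentiable at s"
proof -
  obtain K where K: "\<bar>s\<bar> < K" "K < 1" using s dense by blast
  have "((\<lambda>s. \<Sum>k. iterate \<psi> k x * s ^ k) has_field_derivative (\<Sum>k. diffs (\<lambda>k. iterate \<psi> k x) k * s ^ k)) (at s)"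
    using K by (intro termdiffs_strong[of _ K] neumann_summable x) auto
  thus ?thesis unfolding neumann_def field_differentiable_def by blast
qed

lemma green_eq:
  assumes "x \<in> W" "\<bar>s\<bar> < 1"
  shows "wt x * green s x = (if x = src then 1 else 0) + s * (\<Sum>y\<in>W. w x y * green s y)"
  using neumann_eq[OF assms, of "\<lambda>x. (if x = src then 1 else 0) / wt x"] wt_pos[OF assms(1)]
  by (simp add: green_def)

lemma hit_eq:
  assumes "x \<in> W" "\<bar>s\<bar> < 1"
  shows "wt x * hit s x = s * (b x + (\<Sum>y\<in>W. w x y * hit s y))"
proof -
  have "wt x * hit s x = s * (wt x * neumann (\<lambda>x. b x / wt x) s x)" by (simp add: hit_def)
  also have "\<dots> = s * (b x + s * (\<Sum>y\<in>W. w x y * neumann (\<lambda>x. b x / wt x) s y))"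
    using neumann_eq[OF assms, of "\<lambda>x. b x / wt x"] wt_pos[OF assms(1)] by simp
  also have "s * (\<Sum>y\<in>W. w x y * neumann (\<lambda>x. b x / wt x) s y) = (\<Sum>y\<in>W. w x y * hit s y)"
    by (simp add: hit_def sum_distrib_left mult_ac)
  finally show ?thesis .
qed

lemma src_rate_nonneg: "x \<in> W \<Longrightarrow> 0 \<le> (if x = src then 1 else 0) / wt x"
  using wt_pos[of x] by simp

lemma exit_rate_nonneg: "x \<in> W \<Longrightarrow> 0 \<le> b x / wt x"
  using wt_pos[of x] b_nonneg[of x] by simp

lemma green_nonneg: "x \<in> W \<Longrightarrow> 0 \<le> s \<Longrightarrow> s < 1 \<Longrightarrow> 0 \<le> green s x"
  unfolding green_def by (intro neumann_nonneg src_rate_nonneg)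

lemma hit_nonneg: "x \<in> W \<Longrightarrow> 0 \<le> s \<Longrightarrow> s < 1 \<Longrightarrow> 0 \<le> hit s x"
  unfolding hit_def by (intro mult_nonneg_nonneg neumann_nonneg exit_rate_nonneg)

lemma hit_pos_iff:
  "x \<in> W \<Longrightarrow> 0 < s \<Longrightarrow> s < 1 \<Longrightarrow> 0 < hit s x \<longleftrightarrow> (\<exists>k. 0 < iterate (\<lambda>x. b x / wt x) k x)"
  unfolding hit_def by (subst zero_less_mult_iff) (auto simp: neumann_pos_iff exit_rate_nonneg)

lemma hit_le:
  assumes "x \<in> W" "0 \<le> s" "s < 1"
  shows "hit s x \<le> s"
proof -
  let ?\<psi> = "\<lambda>x. b x / wt x"
  have *: "(\<Sum>k<m. iterate ?\<psi> k x * s ^ k) \<le> 1" if "x \<in> W" for m x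
    using that
  proof (induction m arbitrary: x)
    case (Suc m)
    note x = \<open>x \<in> W\<close>
    have "(\<Sum>k<Suc m. iterate ?\<psi> k x * s ^ k)
       = b x / wt x + s * (\<Sum>y\<in>W. w x y / wt x * (\<Sum>k<m. iterate ?\<psi> k y * s ^ k))"
    proof -
      have "(\<Sum>k<m. iterate ?\<psi> (Suc k) x * s ^ Suc k)
          = (\<Sum>k<m. \<Sum>y\<in>W. s * (w x y / wt x * (iterate ?\<psi> k y * s ^ k)))"
        by (simp add: sum_distrib_left sum_distrib_right sum_divide_distrib mult_ac)
      also have "\<dots> = s * (\<Sum>y\<in>W. w x y / wt x * (\<Sum>k<m. iterate ?\<psi> k y * s ^ k))"
        by (subst sum.swap) (simp only: sum_distrib_left)
      finally show ?thesis by (subst sum.lessThan_Suc_shift) simp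
    qed
    also have "\<dots> \<le> b x / wt x + 1 * (\<Sum>y\<in>W. w x y / wt x * 1)"
    proof (intro add_left_mono mult_mono sum_mono order.refl)
      show "(\<Sum>k<m. iterate ?\<psi> k y * s ^ k) \<le> 1" if "y \<in> W" for y using Suc.IH[OF that] .
      show "0 \<le> (\<Sum>y\<in>W. w x y / wt x * (\<Sum>k<m. iterate ?\<psi> k y * s ^ k))"
        using x assms wt_pos[OF x] w_nonneg iterate_nonneg[of ?\<psi>, OF exit_rate_nonneg]
        by (intro sum_nonneg mult_nonneg_nonneg divide_nonneg_pos) auto
    qed (use assms x wt_pos[OF x] w_nonneg iterate_nonneg[of ?\<psi>, OF exit_rate_nonneg] in
          \<open>auto intro!: sum_nonneg mult_nonneg_nonneg\<close>)
    also have "\<dots> = ((\<Sum>y\<in>W. w x y) + b x) / wt x" by (simp add: sum_divide_distrib add_divide_distrib)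
    also have "\<dots> \<le> 1" using total_le[OF x] wt_pos[OF x] by simp
    finally show ?case .
  qed simp
  have "neumann ?\<psi> s x \<le> 1"
    unfolding neumann_def using * assms by (intro suminf_le_const neumann_summable) auto
  thus ?thesis using assms mult_left_mono[of "neumann ?\<psi> s x" 1 s] by (simp add: hit_def)
qed

lemma hit_src_le:
  assumes "b src = 0" "0 \<le> s" "s < 1"
  shows "hit s src \<le> s * s"
proof -
  have "wt src * hit s src = s * (\<Sum>y\<in>W. w src y * hit s y)"
    using hit_eq[OF src_W, of s] assms by simp
  also have "\<dots> \<le> s * (\<Sum>y\<in>W. w src y * s)"
    using assms src_W by (intro mult_left_mono sum_mono hit_le w_nonneg) auto
  also have "\<dots> = s * s * (\<Sum>y\<in>W. w src y)" by (simp add: sum_distrib_right mult_ac sum_distrib_left)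
  also have "\<dots> \<le> s * s * wt src" using sum_w_le[OF src_W] by (intro mult_left_mono) auto
  finally show ?thesis using wt_pos[OF src_W] by (simp add: mult.commute)
qed

text \<open>
  Here reversibility enters: a path from the source to \<open>x\<close> can be walked backwards, and from the source the target can be
  reached.
\<close>

lemma hit_pos_of_green_pos:
  assumes s: "0 < s" "s < 1" and f: "0 < hit s src" and x: "x \<in> W" and u: "0 < green s x"
  shows "0 < hit s x"
proof -
  obtain k where "0 < iterate (\<lambda>x. (if x = src then 1 else 0) / wt x) k x"
  proof -
    have "0 < neumann (\<lambda>x. (if x = src then 1 else 0) / wt x) s x
        \<longleftrightarrow> (\<exists>k. 0 < iterate (\<lambda>x. (if x = src then 1 else 0) / wt x) k x)"
      by (intro neumann_pos_iff src_rate_nonneg x s)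
    thus ?thesis using u that unfolding green_def by blast
  qed
  thus ?thesis using x
  proof (induction k arbitrary: x)
    case 0
    thus ?case using f by (cases "x = src") auto
  next
    case (Suc k)
    let ?\<beta> = "iterate (\<lambda>x. (if x = src then 1 else 0) / wt x) k"
    have "0 < (\<Sum>y\<in>W. w x y * ?\<beta> y)"
      using Suc.prems wt_pos[OF Suc.prems(2)] by (simp add: zero_less_divide_iff)
    then obtain y where y: "y \<in> W" "0 < w x y * ?\<beta> y"
      by (meson not_less sum_nonpos)
    have "0 \<le> ?\<beta> y" by (intro iterate_nonneg src_rate_nonneg y)
    hence xy: "0 < w x y" "0 < ?\<beta> y"
      using y w_nonneg[OF Suc.prems(2) y(1)] by (auto simp: zero_less_mult_iff)
    have "0 < w x y * hit s y" using xy Suc.IH[OF xy(2) y(1)] by simp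
    also have "\<dots> \<le> (\<Sum>y\<in>W. w x y * hit s y)"
      using finite_W y Suc.prems s by (intro member_le_sum mult_nonneg_nonneg w_nonneg hit_nonneg) auto
    finally have "0 < wt x * hit s x"
      using hit_eq[OF Suc.prems(2), of s] s b_nonneg[OF Suc.prems(2)] by simp
    thus ?case using wt_pos[OF Suc.prems(2)] by (simp add: zero_less_mult_iff)
  qed
qed

lemma tilted_flow_green_hit:
  assumes s: "0 < s" "s < 1" and f: "0 < hit s src"
  shows "tilted_flow W w wt b src s (green s) (hit s)"
proof
  have s': "\<bar>s\<bar> < 1" using s by simp
  show "wt x * green s x = (if x = src then 1 else 0) + s * (\<Sum>y\<in>W. w x y * green s y)" if "x \<in> W" for x
    by (rule green_eq[OF that s'])
  show "wt x * hit s x = s * (b x + (\<Sum>y\<in>W. w x y * hit s y))" if "x \<in> W" for x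
    by (rule hit_eq[OF that s'])
  show "0 < green s y \<and> 0 < hit s x \<and> 0 < hit s y"
    if xy: "x \<in> W" "y \<in> W" "0 < w x y" "0 < green s x" for x y
  proof -
    have "0 < w y x * green s x" using xy w_sym[of x y] by simp
    also have "\<dots> \<le> (\<Sum>x\<in>W. w y x * green s x)"
      using finite_W xy s by (intro member_le_sum mult_nonneg_nonneg w_nonneg green_nonneg) auto
    finally have "0 < wt y * green s y" using green_eq[OF xy(2) s'] s by (auto intro: add_nonneg_pos)
    hence "0 < green s y" using wt_pos[OF xy(2)] by (simp add: zero_less_mult_iff)
    thus ?thesis using xy hit_pos_of_green_pos[OF s f] by blast
  qed
qed (use s f in \<open>auto intro: green_nonneg hit_nonneg hit_le\<close>)

text \<open>
  The resolvent is self-adjoint with respect to \<open>wt\<close>, so its row at the source can be read off from the Green function.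
\<close>

lemma green_pairing:
  assumes s: "\<bar>s\<bar> < 1"
    and h: "\<And>x. x \<in> W \<Longrightarrow> wt x * h x = \<phi> x + s * (\<Sum>y\<in>W. w x y * h y)"
  shows "h src = (\<Sum>x\<in>W. green s x * \<phi> x)"
proof -
  have "(\<Sum>x\<in>W. wt x * green s x * h x) = (\<Sum>x\<in>W. green s x * \<phi> x) + s * (\<Sum>x\<in>W. \<Sum>y\<in>W. green s x * w x y * h y)"
  proof -
    have "(\<Sum>x\<in>W. wt x * green s x * h x) = (\<Sum>x\<in>W. green s x * (\<phi> x + s * (\<Sum>y\<in>W. w x y * h y)))"
      by (intro sum.cong refl) (simp add: h[symmetric])
    thus ?thesis by (simp add: distrib_left sum.distrib sum_distrib_left mult_ac)
  qed
  moreover have "(\<Sum>x\<in>W. wt x * green s x * h x) = h src + s * (\<Sum>x\<in>W. \<Sum>y\<in>W. green s x * w x y * h y)"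
  proof -
    have "(\<Sum>x\<in>W. wt x * green s x * h x) = (\<Sum>x\<in>W. (if x = src then h src else 0) + s * (\<Sum>y\<in>W. green s y * w y x * h x))"
    proof (intro sum.cong refl)
      fix x assume x: "x \<in> W"
      have "(\<Sum>y\<in>W. w x y * green s y) * h x = (\<Sum>y\<in>W. green s y * w y x * h x)"
        unfolding sum_distrib_right using x by (intro sum.cong refl) (simp add: w_sym)
      moreover have "wt x * green s x * h x = (if x = src then 1 else 0) * h x + s * ((\<Sum>y\<in>W. w x y * green s y) * h x)"
        unfolding green_eq[OF x s] by (simp only: distrib_right mult.assoc)
      ultimately show "wt x * green s x * h x = (if x = src then h src else 0) + s * (\<Sum>y\<in>W. green s y * w y x * h x)"
        by simp
    qed
    also have "\<dots> = h src + s * (\<Sum>x\<in>W. \<Sum>y\<in>W. green s y * w y x * h x)"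
      using finite_W src_W by (simp add: sum.distrib sum_distrib_left)
    also have "(\<Sum>x\<in>W. \<Sum>y\<in>W. green s y * w y x * h x) = (\<Sum>x\<in>W. \<Sum>y\<in>W. green s x * w x y * h y)"
      by (rule sum.swap)
    finally show ?thesis .
  qed
  ultimately show ?thesis by simp
qed

text \<open>
  Up to normalisation this is the expected duration of the tilted walk: \<open>s\<close> times the derivative of \<open>E (s ^ T)\<close> is
  \<open>E (T * s ^ T)\<close>, and the two summands count the last step and the steps inside the network. It is obtained without
  multiplying power series: the equation for \<open>hit\<close> is differentiated, and the resulting equation for the derivative is
  solved by \<open>green_pairing\<close>.
\<close>

lemma hit_src_deriv:
  assumes s: "0 < s" "s < 1"
  shows "((\<lambda>s. hit s src) has_real_derivative
      (hit s src + s * (\<Sum>x\<in>W. \<Sum>y\<in>W. w x y * green s x * hit s y)) / s) (at s)"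
proof -
  have s': "\<bar>s\<bar> < 1" using s by simp
  have "(\<lambda>s. hit s x) field_differentiable at s" if "x \<in> W" for x
    unfolding hit_def by (intro field_differentiable_mult field_differentiable_ident neumann_differentiable that s')
  then obtain D where D: "\<And>x. x \<in> W \<Longrightarrow> ((\<lambda>s. hit s x) has_real_derivative D x) (at s)"
    unfolding field_differentiable_def by metis
  have "wt x * D x = wt x * hit s x / s + s * (\<Sum>y\<in>W. w x y * D y)" if x: "x \<in> W" for x
  proof -
    have "((\<lambda>t. wt x * hit t x) has_real_derivative wt x * D x) (at s)"
      by (rule DERIV_cmult[OF D[OF x]])
    moreover have "((\<lambda>t. wt x * hit t x) has_real_derivative
        (b x + (\<Sum>y\<in>W. w x y * hit s y)) + s * (\<Sum>y\<in>W. w x y * D y)) (at s)"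
    proof (rule has_field_derivative_transform_within_open[of _ _ _ "{0<..<1}"])
      show "((\<lambda>t. t * (b x + (\<Sum>y\<in>W. w x y * hit t y))) has_real_derivative
        (b x + (\<Sum>y\<in>W. w x y * hit s y)) + s * (\<Sum>y\<in>W. w x y * D y)) (at s)"
        by (auto intro!: derivative_eq_intros D simp: mult.commute)
    qed (use s x in \<open>auto simp: hit_eq\<close>)
    ultimately have "wt x * D x = (b x + (\<Sum>y\<in>W. w x y * hit s y)) + s * (\<Sum>y\<in>W. w x y * D y)"
      by (rule DERIV_unique)
    thus ?thesis using hit_eq[OF x s'] s by simp
  qed
  hence "D src = (\<Sum>x\<in>W. green s x * (wt x * hit s x / s))" by (rule green_pairing[OF s'])
  also have "\<dots> = (\<Sum>x\<in>W. green s x * b x) + (\<Sum>x\<in>W. \<Sum>y\<in>W. w x y * green s x * hit s y)"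
  proof -
    have "green s x * (wt x * hit s x / s) = green s x * b x + (\<Sum>y\<in>W. w x y * green s x * hit s y)"
      if x: "x \<in> W" for x
    proof -
      have "green s x * (wt x * hit s x / s) = green s x * (b x + (\<Sum>y\<in>W. w x y * hit s y))"
        unfolding hit_eq[OF x s'] using s by simp
      thus ?thesis by (simp add: distrib_left sum_distrib_left mult_ac)
    qed
    thus ?thesis by (simp add: sum.distrib)
  qed
  also have "(\<Sum>x\<in>W. green s x * b x) = hit s src / s"
  proof -
    have "hit s src = (\<Sum>x\<in>W. green s x * (s * b x))"
      by (rule green_pairing[OF s']) (simp add: hit_eq[OF _ s'] distrib_left)
    also have "\<dots> = s * (\<Sum>x\<in>W. green s x * b x)" by (simp add: sum_distrib_left mult_ac)
    finally show ?thesis using s by simp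
  qed
  finally show ?thesis using D[OF src_W] s by (simp add: add_divide_distrib)
qed


end

section \<open>The differential inequality\<close>

context killed_network begin

text \<open>
  Write \<open>hit s src = s * h s ^ n\<close>. The lower bounds for the duration of the tilted walk, used with
  \<open>G = g / (h s)\<^sup>2\<close>, say that the logarithmic derivative of \<open>h\<close> is at least \<open>(g + h\<^sup>2) / (g - h\<^sup>2)\<close>. Equality holds
  for \<open>s = (g + 1) * h / (g + h\<^sup>2)\<close>, the relation which defines the transform \<open>h\<close> of the time that the walk on the line
  with bias \<open>g\<close> needs for one step to the right; tilting turns its bias \<open>g\<close> into \<open>g / h\<^sup>2\<close>. Hence the function
  \<open>Q = ln s - ln ((g + 1) * h / (g + h\<^sup>2))\<close> is decreasing in \<open>s\<close>. Since \<open>h \<le> 1\<close> gives \<open>Q t \<ge> ln t\<close>, which tends to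
  \<open>0\<close> for \<open>t\<close> tending to \<open>1\<close>, it is nonnegative, and this is the claimed inequality.
\<close>

lemma hit_src_subsolution:
  fixes d :: "'a \<Rightarrow> real" and n :: nat and g B :: real
  assumes d_src: "d src = 0"
    and d_lipschitz: "\<And>x y. x \<in> W \<Longrightarrow> y \<in> W \<Longrightarrow> 0 < w x y \<Longrightarrow> \<bar>d y - d x\<bar> \<le> 1"
    and d_exit: "\<And>x. x \<in> W \<Longrightarrow> 0 < b x \<Longrightarrow> d x = real n"
    and d_first: "\<And>y. y \<in> W \<Longrightarrow> 0 < w src y \<Longrightarrow> y \<noteq> src \<Longrightarrow> d y = 1"
    and n: "1 \<le> n" and g: "1 \<le> g" and B: "(\<Sum>x\<in>W. b x) \<le> B" "0 < B"
    and growth: "1 < g \<and> 2 * (B / wt src) \<le> g ^ n * (1 - 1 / g)\<^sup>2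
      \<or> (\<forall>s. 0 < s \<longrightarrow> s < 1 \<longrightarrow> green s src * B \<le> g ^ n)"
    and s: "0 < s" "s < 1" and f: "0 < hit s src"
  shows "\<exists>h. 0 < h \<and> h \<le> 1 \<and> hit s src = s * h ^ n \<and> (g + 1) * h \<le> s * (g + h\<^sup>2)"
proof -
  have b_src: "b src = 0"
    using d_exit[OF src_W] b_nonneg[OF src_W] d_src n by (cases "b src = 0") auto
  have pos: "0 < hit t src" if "0 < t" "t < 1" for t
    using f hit_pos_iff[OF src_W] s that by blast
  \<comment> \<open>\<open>H\<close> is \<open>ln h\<close>.\<close>
  define H where "H t = (ln (hit t src) - ln t) / real n" for t
  define Q where "Q t = ln t - ln (g + 1) - H t + ln (g + exp (2 * H t))" for t
  have H_neg: "H t < 0" if t: "0 < t" "t < 1" for t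
  proof -
    have "hit t src \<le> t * t" using hit_src_le[OF b_src] t by simp
    also have "\<dots> < t" using t by simp
    finally show ?thesis using pos[OF t] t n by (simp add: H_def divide_neg_pos)
  qed
  have H_pow: "exp (H t) ^ n = hit t src / t" if t: "0 < t" "t < 1" for t
  proof -
    have "exp (H t) ^ n = exp (ln (hit t src / t))"
      using n t pos[OF t] by (simp add: exp_of_nat_mult[symmetric] H_def ln_div)
    thus ?thesis using t pos[OF t] by simp
  qed
  have exp2: "exp (2 * H t) = (exp (H t))\<^sup>2" for t by (simp add: exp_double)
  have deriv: "\<exists>D. (Q has_real_derivative D) (at t) \<and> D \<le> 0" if t: "0 < t" "t < 1" for t
  proof -
    define S where "S = t * (\<Sum>x\<in>W. \<Sum>y\<in>W. w x y * green t x * hit t y)"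
    define e where "e = exp (2 * H t)"
    define G where "G = g / e"
    define H' where "H' = ((hit t src + S) / t / hit t src - 1 / t) / real n"
    have e: "0 < e" "e < 1" using H_neg[OF t] by (auto simp: e_def)
    have G: "1 < G" "g \<le> G" using e g by (auto simp: G_def pos_less_divide_eq pos_le_divide_eq)
    have Gn: "G ^ n = g ^ n * (t\<^sup>2 / (hit t src)\<^sup>2)"
    proof -
      have "e ^ n = (hit t src / t)\<^sup>2"
        unfolding H_pow[OF t, symmetric] e_def exp2 by (simp add: power_mult[symmetric] mult.commute)
      thus ?thesis using t pos[OF t] by (simp add: G_def power_divide)
    qed
    interpret tilted_flow W w wt b src t "green t" "hit t"
      by (rule tilted_flow_green_hit[OF t pos[OF t]])
    have steps: "real n * (G + 1) / (G - 1) * hit t src \<le> S"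
      using growth
    proof
      assume a: "1 < g \<and> 2 * (B / wt src) \<le> g ^ n * (1 - 1 / g)\<^sup>2"
      have "2 * (B / wt src * t\<^sup>2 / (hit t src)\<^sup>2) = 2 * (B / wt src) * (t\<^sup>2 / (hit t src)\<^sup>2)" by simp
      also have "\<dots> \<le> g ^ n * (1 - 1 / g)\<^sup>2 * (t\<^sup>2 / (hit t src)\<^sup>2)"
        using a by (intro mult_right_mono) auto
      also have "\<dots> = G ^ n * (1 - 1 / g)\<^sup>2" by (simp add: Gn)
      also have "\<dots> \<le> G ^ n * (1 - 1 / G)\<^sup>2"
        using a G by (intro mult_left_mono power_mono diff_left_mono divide_left_mono) auto
      finally show ?thesis unfolding S_def
        by (intro steps_ge_source_weight[of d n G B] d_src d_lipschitz d_exit d_first B G n b_src) auto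
    next
      assume "\<forall>s. 0 < s \<longrightarrow> s < 1 \<longrightarrow> green s src * B \<le> g ^ n"
      hence "green t src * B * (t\<^sup>2 / (hit t src)\<^sup>2) \<le> g ^ n * (t\<^sup>2 / (hit t src)\<^sup>2)"
        using t by (intro mult_right_mono) auto
      hence "green t src * B * t\<^sup>2 / (hit t src)\<^sup>2 \<le> G ^ n" by (simp add: Gn)
      thus ?thesis unfolding S_def
        by (intro steps_ge_resistance[of d n G B] d_src d_lipschitz d_exit B G) auto
    qed
    have ratio: "(G + 1) / (G - 1) = (g + e) / (g - e)"
    proof -
      have "G + 1 = (g + e) / e" "G - 1 = (g - e) / e" using e by (auto simp: G_def field_simps)
      thus ?thesis using e by simp
    qed
    have "real n * ((G + 1) / (G - 1)) * hit t src \<le> S" using steps by simp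
    hence S: "real n * ((g + e) / (g - e)) \<le> S / hit t src"
      unfolding ratio pos_le_divide_eq[OF pos[OF t]] .
    have "t * H' = S / hit t src / real n"
      using t pos[OF t] n by (simp add: H'_def field_simps)
    moreover have "(g + e) / (g - e) \<le> S / hit t src / real n"
      using S n by (subst pos_le_divide_eq) (auto simp: mult.commute)
    ultimately have tH': "(g + e) / (g - e) \<le> t * H'" by simp
    have dH: "(H has_real_derivative H') (at t)"
    proof -
      have "((\<lambda>t. hit t src) has_real_derivative (hit t src + S) / t) (at t)"
        using hit_src_deriv[OF t] by (simp add: S_def)
      hence "((\<lambda>t. ln (hit t src)) has_real_derivative (1 / hit t src) * ((hit t src + S) / t)) (at t)"
        by (rule DERIV_chain2[where f = ln and g = "\<lambda>t. hit t src", OF DERIV_ln_divide[OF pos[OF t]]])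
      hence "((\<lambda>t. (ln (hit t src) - ln t) / real n) has_real_derivative
          ((1 / hit t src) * ((hit t src + S) / t) - 1 / t) / real n) (at t)"
        by (intro DERIV_cdivide DERIV_diff DERIV_ln_divide t)
      thus ?thesis by (simp add: H_def[abs_def] H'_def mult.commute)
    qed
    have gexp: "0 < g + exp (2 * H t)" using g by (simp add: add_pos_pos)
    have dQ: "(Q has_real_derivative (1 / t - H' + 2 * H' * e / (g + e))) (at t)"
    proof -
      have "((\<lambda>t. exp (2 * H t)) has_real_derivative exp (2 * H t) * (2 * H')) (at t)"
        by (intro DERIV_chain2[OF DERIV_exp] DERIV_cmult dH)
      hence "((\<lambda>t. g + exp (2 * H t)) has_real_derivative 0 + exp (2 * H t) * (2 * H')) (at t)"
        by (intro DERIV_add DERIV_const)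
      hence "((\<lambda>t. ln (g + exp (2 * H t))) has_real_derivative
          1 / (g + exp (2 * H t)) * (0 + exp (2 * H t) * (2 * H'))) (at t)"
        by (rule DERIV_chain2[where f = ln and g = "\<lambda>t. g + exp (2 * H t)", OF DERIV_ln_divide[OF gexp]])
      hence "(Q has_real_derivative 1 / t - 0 - H' + 1 / (g + exp (2 * H t)) * (0 + exp (2 * H t) * (2 * H'))) (at t)"
        unfolding Q_def[abs_def] by (intro DERIV_add DERIV_diff DERIV_ln_divide t dH DERIV_const)
      thus ?thesis by (simp add: e_def mult_ac)
    qed
    have "1 / t - H' + 2 * H' * e / (g + e) = (1 - t * H' * ((g - e) / (g + e))) / t"
      using t e g by (simp add: divide_simps) (simp add: algebra_simps)
    also have "\<dots> \<le> 0"
    proof -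
      have "1 = (g + e) / (g - e) * ((g - e) / (g + e))" using e g by simp
      also have "\<dots> \<le> t * H' * ((g - e) / (g + e))" using tH' e g by (intro mult_right_mono) auto
      finally show ?thesis using t by (simp add: divide_nonpos_pos)
    qed
    finally show ?thesis using dQ by blast
  qed
  have Q_ge: "ln t \<le> Q t" if t: "0 < t" "t < 1" for t
  proof -
    define h where "h = exp (H t)"
    have h: "0 < h" "h \<le> 1" using H_neg[OF t] by (auto simp: h_def)
    have "0 \<le> (1 - h) * (g - h)" using h g by (intro mult_nonneg_nonneg) auto
    hence "(g + 1) * h \<le> g + h\<^sup>2" by (simp add: algebra_simps power2_eq_square)
    hence "ln ((g + 1) * h) \<le> ln (g + h\<^sup>2)"
      using g h by (subst ln_le_cancel_iff) (auto intro: add_pos_pos)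
    moreover have "ln ((g + 1) * h) = ln (g + 1) + H t" using g by (simp add: h_def ln_mult)
    ultimately show ?thesis by (simp add: Q_def exp2 h_def)
  qed
  have "ln t \<le> Q s" if t: "s < t" "t < 1" for t
  proof -
    have "ln t \<le> Q t" using Q_ge t s by simp
    also have "Q t \<le> Q s"
      using t s by (intro DERIV_nonpos_imp_nonincreasing[of s t Q] deriv) auto
    finally show ?thesis .
  qed
  hence "eventually (\<lambda>t. ln t \<le> Q s) (at_left (1::real))"
    using s eventually_at_left_real[of s 1] by (auto elim!: eventually_mono)
  moreover have "(ln \<longlongrightarrow> ln 1) (at_left (1::real))" by (intro tendsto_intros) auto
  ultimately have "ln 1 \<le> Q s"
    by (intro tendsto_upperbound[of ln "ln 1" "at_left (1::real)"]) auto
  define h where "h = exp (H s)"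
  have h: "0 < h" "h \<le> 1" using H_neg[OF s] by (auto simp: h_def)
  have hn: "hit s src = s * h ^ n" using H_pow[OF s] s by (simp add: h_def)
  have "ln ((g + 1) * h) \<le> ln (s * (g + h\<^sup>2))"
  proof -
    have "0 < g + h\<^sup>2" using g h by (intro add_pos_pos) auto
    hence "ln (s * (g + h\<^sup>2)) = ln s + ln (g + h\<^sup>2)" using s by (simp add: ln_mult)
    moreover have "ln ((g + 1) * h) = ln (g + 1) + H s" using g by (simp add: h_def ln_mult)
    ultimately show ?thesis using \<open>ln 1 \<le> Q s\<close> by (simp add: Q_def exp2 h_def)
  qed
  moreover have "0 < s * (g + h\<^sup>2)" using s g h by (intro mult_pos_pos add_pos_pos) auto
  ultimately have "(g + 1) * h \<le> s * (g + h\<^sup>2)"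
    using g h by (subst (asm) ln_le_cancel_iff) auto
  thus ?thesis using h hn by blast
qed

end

section \<open>Green functions and effective resistance\<close>

text \<open>
  Dirichlet's principle. The Dirichlet form \<open>E\<close> satisfies \<open>E \<phi> v = \<phi> x0\<close> for every \<open>\<phi>\<close> that vanishes on \<open>z\<close>, in
  particular \<open>E v v = v x0\<close>, so the claim is \<open>0 \<le> E (v - \<phi>) (v - \<phi>)\<close>.
\<close>

lemma dirichlet_lower_bound:
  fixes w :: "'a \<Rightarrow> 'a \<Rightarrow> real"
  assumes fin: "finite W" and x0: "x0 \<in> W" "x0 \<notin> z"
    and sym: "\<And>x y. x \<in> W \<Longrightarrow> y \<in> W \<Longrightarrow> w x y = w y x"
    and nn: "\<And>x y. x \<in> W \<Longrightarrow> y \<in> W \<Longrightarrow> 0 \<le> w x y"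
    and v: "unit_voltage w x0 z W v"
    and \<phi>: "\<And>x. x \<in> W \<inter> z \<Longrightarrow> \<phi> x = 0"
  shows "2 * \<phi> x0 - (\<Sum>x\<in>W. \<phi> x * (\<Sum>y\<in>W. w x y * (\<phi> x - \<phi> y))) \<le> v x0"
proof -
  define E where "E p q = (\<Sum>x\<in>W. \<Sum>y\<in>W. w x y * (p x - p y) * (q x - q y)) / 2" for p q :: "'a \<Rightarrow> real"
  have E: "E p q = (\<Sum>x\<in>W. p x * (\<Sum>y\<in>W. w x y * (q x - q y)))" for p q
  proof -
    have "(\<Sum>x\<in>W. \<Sum>y\<in>W. w x y * p y * (q x - q y)) = (\<Sum>y\<in>W. \<Sum>x\<in>W. w x y * p y * (q x - q y))"
      by (rule sum.swap)
    also have "\<dots> = (\<Sum>y\<in>W. \<Sum>x\<in>W. - (w y x * p y * (q y - q x)))"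
      by (intro sum.cong refl) (simp add: sym algebra_simps)
    finally have "(\<Sum>x\<in>W. \<Sum>y\<in>W. w x y * p y * (q x - q y)) = - (\<Sum>x\<in>W. \<Sum>y\<in>W. w x y * p x * (q x - q y))"
      by (simp add: sum_negf)
    moreover have "(\<Sum>x\<in>W. \<Sum>y\<in>W. w x y * (p x - p y) * (q x - q y))
        = (\<Sum>x\<in>W. \<Sum>y\<in>W. w x y * p x * (q x - q y)) - (\<Sum>x\<in>W. \<Sum>y\<in>W. w x y * p y * (q x - q y))"
      by (simp add: sum_subtractf[symmetric] algebra_simps)
    ultimately have "E p q = (\<Sum>x\<in>W. \<Sum>y\<in>W. w x y * p x * (q x - q y))" by (simp add: E_def)
    thus ?thesis by (simp add: sum_distrib_left mult_ac)
  qed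
  have Ev: "E p v = p x0" if p: "\<And>x. x \<in> W \<inter> z \<Longrightarrow> p x = 0" for p
  proof -
    have "E p v = (\<Sum>x\<in>W. if x = x0 then p x0 else 0)"
      unfolding E
    proof (intro sum.cong refl)
      fix x assume x: "x \<in> W"
      show "p x * (\<Sum>y\<in>W. w x y * (v x - v y)) = (if x = x0 then p x0 else 0)"
      proof (cases "x \<in> z")
        case True
        thus ?thesis using p[of x] x x0 by auto
      next
        case False
        thus ?thesis using v x by (simp add: unit_voltage_def)
      qed
    qed
    thus ?thesis using fin x0 by simp
  qed
  have vz: "v x = 0" if "x \<in> W \<inter> z" for x using v that by (simp add: unit_voltage_def)
  have "0 \<le> E (\<lambda>x. v x - \<phi> x) (\<lambda>x. v x - \<phi> x)"
    unfolding E_def by (intro divide_nonneg_pos sum_nonneg) (auto simp: mult.assoc nn intro!: mult_nonneg_nonneg)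
  also have "\<dots> = E v v - 2 * E \<phi> v + E \<phi> \<phi>"
  proof -
    let ?e = "\<lambda>p q x y. w x y * (p x - p y) * (q x - q y) :: real"
    have "(\<Sum>x\<in>W. \<Sum>y\<in>W. ?e (\<lambda>x. v x - \<phi> x) (\<lambda>x. v x - \<phi> x) x y)
        = (\<Sum>x\<in>W. \<Sum>y\<in>W. ?e v v x y - 2 * ?e \<phi> v x y + ?e \<phi> \<phi> x y)"
      by (intro sum.cong refl) (simp add: algebra_simps)
    also have "\<dots> = (\<Sum>x\<in>W. \<Sum>y\<in>W. ?e v v x y) - 2 * (\<Sum>x\<in>W. \<Sum>y\<in>W. ?e \<phi> v x y)
        + (\<Sum>x\<in>W. \<Sum>y\<in>W. ?e \<phi> \<phi> x y)"
      by (simp only: sum.distrib sum_subtractf sum_distrib_left)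
    finally show ?thesis unfolding E_def by simp
  qed
  also have "\<dots> = v x0 - 2 * \<phi> x0 + E \<phi> \<phi>" using Ev vz \<phi> by simp
  finally show ?thesis unfolding E by simp
qed

text \<open>
  The Green function is a test function for Dirichlet's principle whose energy is at most its value at the source, because
  killing and discounting only increase the form.
\<close>

lemma (in killed_network) green_le_voltage:
  assumes W': "finite W'" "W \<subseteq> W'" "W \<inter> z = {}"
    and sym': "\<And>x y. x \<in> W' \<Longrightarrow> y \<in> W' \<Longrightarrow> w x y = w y x"
    and nn': "\<And>x y. x \<in> W' \<Longrightarrow> y \<in> W' \<Longrightarrow> 0 \<le> w x y"
    and wt': "\<And>x. x \<in> W \<Longrightarrow> (\<Sum>y\<in>W'. w x y) \<le> wt x"
    and v: "unit_voltage w src z W' v"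
    and s: "0 < s" "s < 1"
  shows "green s src \<le> v src"
proof -
  define \<phi> where "\<phi> x = (if x \<in> W then green s x else 0)" for x
  have s': "\<bar>s\<bar> < 1" using s by simp
  have "2 * \<phi> src - (\<Sum>x\<in>W'. \<phi> x * (\<Sum>y\<in>W'. w x y * (\<phi> x - \<phi> y))) \<le> v src"
    using W' src_W by (intro dirichlet_lower_bound[OF _ _ _ _ _ v] sym' nn') (auto simp: \<phi>_def)
  moreover have "(\<Sum>x\<in>W'. \<phi> x * (\<Sum>y\<in>W'. w x y * (\<phi> x - \<phi> y))) \<le> green s src"
  proof -
    have "(\<Sum>x\<in>W'. \<phi> x * (\<Sum>y\<in>W'. w x y * (\<phi> x - \<phi> y)))
        = (\<Sum>x\<in>W. green s x * (\<Sum>y\<in>W'. w x y * (green s x - \<phi> y)))"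
      using W' by (intro sum.mono_neutral_cong_right) (auto simp: \<phi>_def)
    also have "\<dots> \<le> (\<Sum>x\<in>W. green s x * (if x = src then 1 else 0))"
    proof (intro sum_mono mult_left_mono)
      fix x assume x: "x \<in> W"
      show "0 \<le> green s x" using x s by (intro green_nonneg) auto
      have "(\<Sum>y\<in>W'. w x y * \<phi> y) = (\<Sum>y\<in>W. w x y * green s y)"
        using W' by (intro sum.mono_neutral_cong_right) (auto simp: \<phi>_def)
      hence "(\<Sum>y\<in>W'. w x y * (green s x - \<phi> y)) = (\<Sum>y\<in>W'. w x y) * green s x - (\<Sum>y\<in>W. w x y * green s y)"
        by (simp add: right_diff_distrib sum_subtractf sum_distrib_right)
      also have "\<dots> \<le> wt x * green s x - s * (\<Sum>y\<in>W. w x y * green s y)"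
      proof (intro diff_mono mult_right_mono wt' x green_nonneg)
        have "0 \<le> (\<Sum>y\<in>W. w x y * green s y)"
          using x s by (intro sum_nonneg mult_nonneg_nonneg w_nonneg green_nonneg) auto
        thus "s * (\<Sum>y\<in>W. w x y * green s y) \<le> (\<Sum>y\<in>W. w x y * green s y)"
          using s mult_right_mono[of s 1] by simp
      qed (use s in auto)
      also have "\<dots> = (if x = src then 1 else 0)" using green_eq[OF x s'] by simp
      finally show "(\<Sum>y\<in>W'. w x y * (green s x - \<phi> y)) \<le> (if x = src then 1 else 0)" .
    qed
    also have "\<dots> = (\<Sum>x\<in>W. if x = src then green s src else 0)" by (intro sum.cong) auto
    also have "\<dots> = green s src" using finite_W src_W by simp
    finally show ?thesis .
  qed
  ultimately show ?thesis using src_W by (simp add: \<phi>_def)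
qed

locale graph_target =
  fixes V :: "'a set" and w :: "'a \<Rightarrow> 'a \<Rightarrow> real" and x0 :: 'a and z :: "'a set"
  assumes graph: "weighted_graph V w" and x0_V: "x0 \<in> V" and z_V: "z \<subseteq> V" and x0_z: "x0 \<notin> z"
    and z_summable: "vertex_weight V w summable_on z"
begin

definition into_z :: "'a \<Rightarrow> real" where
  "into_z x = (\<Sum>\<^sub>\<infinity>y\<in>z. w x y)"

lemma weight_sym: "x \<in> V \<Longrightarrow> y \<in> V \<Longrightarrow> w x y = w y x"
  and weight_nonneg: "x \<in> V \<Longrightarrow> y \<in> V \<Longrightarrow> 0 \<le> w x y"
  and weight_summable: "x \<in> V \<Longrightarrow> w x summable_on V"
  and vertex_weight_pos: "x \<in> V \<Longrightarrow> 0 < vertex_weight V w x"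
  using graph by (auto simp: weighted_graph_def)

lemma vertex_weight_nonneg: "x \<in> V \<Longrightarrow> 0 \<le> vertex_weight V w x"
  using vertex_weight_pos[of x] by simp

lemma summable_z: "x \<in> V \<Longrightarrow> w x summable_on z"
  using summable_on_subset_banach[OF weight_summable z_V] by blast

lemma sum_le_vertex_weight:
  assumes "x \<in> V" "finite F" "F \<subseteq> V"
  shows "(\<Sum>y\<in>F. w x y) \<le> vertex_weight V w x"
  unfolding vertex_weight_def using assms weight_nonneg
  by (intro finite_sum_le_infsum weight_summable) auto

lemma killed_network:
  assumes W: "finite W" "W \<subseteq> V - z" "x0 \<in> W"
  shows "killed_network W w (vertex_weight V w) into_z x0"
proof
  show "(\<Sum>y\<in>W. w x y) + into_z x \<le> vertex_weight V w x" if x: "x \<in> W" for x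
  proof -
    have xV: "x \<in> V" using x W by auto
    have "(\<Sum>y\<in>W. w x y) + into_z x = (\<Sum>\<^sub>\<infinity>y\<in>W \<union> z. w x y)"
    proof -
      have "(\<Sum>\<^sub>\<infinity>y\<in>W \<union> z. w x y) = (\<Sum>\<^sub>\<infinity>y\<in>W. w x y) + (\<Sum>\<^sub>\<infinity>y\<in>z. w x y)"
        by (intro infsum_Un_disjoint summable_on_finite W summable_z xV) (use W in auto)
      thus ?thesis using W by (simp add: into_z_def)
    qed
    also have "\<dots> \<le> vertex_weight V w x"
    proof -
      have sub: "W \<union> z \<subseteq> V" using W z_V by auto
      show ?thesis unfolding vertex_weight_def
        by (rule infsum_mono2[OF summable_on_subset_banach[OF weight_summable[OF xV] sub] weight_summable[OF xV] sub])
          (auto intro: weight_nonneg xV)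
    qed
    finally show ?thesis .
  qed
  show "0 \<le> into_z x" if "x \<in> W" for x
    unfolding into_z_def using that W z_V by (intro infsum_nonneg weight_nonneg) auto
  show "w x y = w y x" "0 \<le> w x y" if "x \<in> W" "y \<in> W" for x y
    using that W by (auto intro: weight_sym weight_nonneg)
  show "0 < vertex_weight V w x" if "x \<in> W" for x
    using that W by (auto intro: vertex_weight_pos)
qed (use W in auto)

lemma sum_sum_z_le:
  assumes W: "finite W" "W \<subseteq> V" and F: "finite F" "F \<subseteq> z"
  shows "(\<Sum>x\<in>W. \<Sum>y\<in>F. w x y) \<le> set_weight V w z"
proof -
  have "(\<Sum>x\<in>W. \<Sum>y\<in>F. w x y) = (\<Sum>y\<in>F. \<Sum>x\<in>W. w y x)"
    using W F z_V by (subst sum.swap) (auto intro!: sum.cong intro: weight_sym)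
  also have "\<dots> \<le> (\<Sum>y\<in>F. vertex_weight V w y)"
    using W F z_V by (intro sum_mono sum_le_vertex_weight) auto
  also have "\<dots> \<le> set_weight V w z"
    unfolding set_weight_def using F z_V
    by (intro finite_sum_le_infsum z_summable) (auto intro: vertex_weight_nonneg)
  finally show ?thesis .
qed

lemma sum_into_z_le:
  assumes W: "finite W" "W \<subseteq> V"
  shows "(\<Sum>x\<in>W. into_z x) \<le> set_weight V w z"
proof (rule tendsto_upperbound)
  show "((\<lambda>F. \<Sum>x\<in>W. \<Sum>y\<in>F. w x y) \<longlongrightarrow> (\<Sum>x\<in>W. into_z x)) (finite_subsets_at_top z)"
    unfolding into_z_def using W summable_z by (intro tendsto_sum infsum_tendsto) auto
  show "eventually (\<lambda>F. (\<Sum>x\<in>W. \<Sum>y\<in>F. w x y) \<le> set_weight V w z) (finite_subsets_at_top z)"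
    using W by (intro eventually_finite_subsets_at_top_weakI sum_sum_z_le)
qed auto

text \<open>
  The effective resistance is a lower limit along the finite subnetworks, so that it is nearly attained on subnetworks
  containing any prescribed finite set.
\<close>

lemma near_optimal_voltage:
  assumes fin: "effective_resistance V w x0 z < \<infinity>" and \<epsilon>: "0 < \<epsilon>" and W: "finite W" "W \<subseteq> V"
  shows "\<exists>W' v. finite W' \<and> W \<subseteq> W' \<and> W' \<subseteq> V \<and> unit_voltage w x0 z W' v \<and>
    v x0 \<le> enn2real (effective_resistance V w x0 z) + \<epsilon>"
proof -
  define R where "R = enn2real (effective_resistance V w x0 z)"
  have R: "effective_resistance V w x0 z = ennreal R" "0 \<le> R" using fin by (auto simp: R_def)
  have "\<not> eventually (\<lambda>W. ennreal (R + \<epsilon>) \<le> finite_resistance w x0 z W) (finite_subsets_at_top V)"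
  proof
    assume "eventually (\<lambda>W. ennreal (R + \<epsilon>) \<le> finite_resistance w x0 z W) (finite_subsets_at_top V)"
    hence "ennreal (R + \<epsilon>) \<le> ennreal R"
      unfolding R(1)[symmetric] effective_resistance_def by (rule Liminf_bounded)
    thus False using \<epsilon> R by simp
  qed
  hence "\<exists>W'. finite W' \<and> W \<subseteq> W' \<and> W' \<subseteq> V \<and> \<not> ennreal (R + \<epsilon>) \<le> finite_resistance w x0 z W'"
    using W by (auto simp: eventually_finite_subsets_at_top)
  then obtain W' where W': "finite W'" "W \<subseteq> W'" "W' \<subseteq> V"
      and "\<not> ennreal (R + \<epsilon>) \<le> finite_resistance w x0 z W'"
    by auto
  hence "finite_resistance w x0 z W' < ennreal (R + \<epsilon>)" by (simp add: not_le)
  then obtain v where v: "unit_voltage w x0 z W' v" "ennreal (v x0) < ennreal (R + \<epsilon>)"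
    unfolding finite_resistance_def INF_less_iff by blast
  hence "v x0 \<le> R + \<epsilon>"
    using R \<epsilon> ennreal_less_iff[of "v x0" "R + \<epsilon>"] by (cases "0 \<le> v x0") (auto simp del: ennreal_plus)
  thus ?thesis using W' v(1) unfolding R_def by blast
qed

lemma green_le_resistance:
  assumes fin: "effective_resistance V w x0 z < \<infinity>"
    and W: "finite W" "W \<subseteq> V - z" "x0 \<in> W" and s: "0 < s" "s < 1"
  shows "killed_network.green W w (vertex_weight V w) x0 s x0 \<le> enn2real (effective_resistance V w x0 z)"
proof (rule field_le_epsilon)
  fix \<epsilon> :: real assume "0 < \<epsilon>"
  have "W \<subseteq> V" using W by auto
  from near_optimal_voltage[OF fin \<open>0 < \<epsilon>\<close> W(1) this]
  obtain W' v where W': "finite W'" "W \<subseteq> W'" "W' \<subseteq> V" "unit_voltage w x0 z W' v"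
    "v x0 \<le> enn2real (effective_resistance V w x0 z) + \<epsilon>" by auto
  interpret killed_network W w "vertex_weight V w" into_z x0 by (rule killed_network[OF W])
  have "green s x0 \<le> v x0"
  proof (rule green_le_voltage[OF W'(1,2) _ _ _ _ W'(4) s])
    show "w x y = w y x" "0 \<le> w x y" if "x \<in> W'" "y \<in> W'" for x y
      using that W' by (auto intro: weight_sym weight_nonneg)
    show "(\<Sum>y\<in>W'. w x y) \<le> vertex_weight V w x" if "x \<in> W" for x
      using that W W' by (intro sum_le_vertex_weight) auto
  qed (use W in auto)
  thus "green s x0 \<le> enn2real (effective_resistance V w x0 z) + \<epsilon>" using W' by simp
qed

text \<open>
  The test function for Dirichlet's principle is constant off \<open>z\<close>; its energy is carried by the edges into \<open>z\<close>, whose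
  total conductance is at most the weight of \<open>z\<close>.
\<close>

lemma weight_resistance_ge_1:
  assumes fin: "effective_resistance V w x0 z < \<infinity>"
  shows "1 \<le> set_weight V w z * enn2real (effective_resistance V w x0 z)"
proof -
  define B where "B = set_weight V w z"
  define R where "R = enn2real (effective_resistance V w x0 z)"
  have B0: "0 \<le> B" unfolding B_def set_weight_def
    using z_V by (intro infsum_nonneg vertex_weight_nonneg) auto
  have bound: "2 * t - t\<^sup>2 * B \<le> R" for t
  proof (rule field_le_epsilon)
    fix \<epsilon> :: real assume "0 < \<epsilon>"
    from near_optimal_voltage[OF fin this, of "{x0}"] x0_V
    obtain W' v where W': "finite W'" "{x0} \<subseteq> W'" "W' \<subseteq> V" "unit_voltage w x0 z W' v" "v x0 \<le> R + \<epsilon>"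
      unfolding R_def[symmetric] by auto
    define \<phi> where "\<phi> x = (if x \<in> z then 0 else t)" for x
    have "2 * \<phi> x0 - (\<Sum>x\<in>W'. \<phi> x * (\<Sum>y\<in>W'. w x y * (\<phi> x - \<phi> y))) \<le> v x0"
      using W' x0_z by (intro dirichlet_lower_bound[OF W'(1) _ _ _ _ W'(4)] weight_sym weight_nonneg) (auto simp: \<phi>_def)
    moreover have "(\<Sum>x\<in>W'. \<phi> x * (\<Sum>y\<in>W'. w x y * (\<phi> x - \<phi> y))) = t\<^sup>2 * (\<Sum>x\<in>W' - z. \<Sum>y\<in>W' \<inter> z. w x y)"
    proof -
      have "(\<Sum>x\<in>W'. \<phi> x * (\<Sum>y\<in>W'. w x y * (\<phi> x - \<phi> y))) = (\<Sum>x\<in>W' - z. t * (\<Sum>y\<in>W' \<inter> z. w x y * t))"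
        using W' by (intro sum.mono_neutral_cong_right)
          (auto simp: \<phi>_def intro!: arg_cong2[of _ _ _ _ "(*)"] sum.mono_neutral_cong_right split: if_splits)
      thus ?thesis by (simp add: sum_distrib_left power2_eq_square mult_ac)
    qed
    moreover have "(\<Sum>x\<in>W' - z. \<Sum>y\<in>W' \<inter> z. w x y) \<le> B"
      unfolding B_def using W' by (intro sum_sum_z_le) auto
    hence "t\<^sup>2 * (\<Sum>x\<in>W' - z. \<Sum>y\<in>W' \<inter> z. w x y) \<le> t\<^sup>2 * B" by (intro mult_left_mono) auto
    ultimately show "2 * t - t\<^sup>2 * B \<le> R + \<epsilon>" using W'(5) x0_z by (simp add: \<phi>_def)
  qed
  have "B \<noteq> 0" using bound[of "(R + 1) / 2"] by auto
  hence Bpos: "0 < B" using B0 by simp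
  have "1 / B \<le> R" using bound[of "1 / B"] Bpos by (simp add: power2_eq_square)
  thus ?thesis using Bpos by (simp add: B_def R_def field_simps)
qed

end

section \<open>Paths and hitting times of discrete Markov chains\<close>

lemma hitting_time_eq:
  "hitting_time X A \<omega> = (if \<exists>k. X k \<omega> \<in> A then enat (LEAST k. X k \<omega> \<in> A) else \<infinity>)"
proof (cases "\<exists>k. X k \<omega> \<in> A")
  case True
  hence "X (LEAST k. X k \<omega> \<in> A) \<omega> \<in> A" by (rule LeastI_ex)
  hence "(INF k\<in>{k. X k \<omega> \<in> A}. enat k) = enat (LEAST k. X k \<omega> \<in> A)"
    by (intro antisym INF_lower INF_greatest) (auto intro: Least_le)
  thus ?thesis using True by (simp add: hitting_time_def)
qed (simp add: hitting_time_def top_enat_def)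

lemma hitting_time_eq_enat_iff:
  "hitting_time X A \<omega> = enat k \<longleftrightarrow> X k \<omega> \<in> A \<and> (\<forall>i<k. X i \<omega> \<notin> A)"
proof
  assume "hitting_time X A \<omega> = enat k"
  hence "\<exists>k. X k \<omega> \<in> A" and k: "k = (LEAST k. X k \<omega> \<in> A)"
    by (auto simp: hitting_time_eq split: if_splits)
  thus "X k \<omega> \<in> A \<and> (\<forall>i<k. X i \<omega> \<notin> A)"
    using not_less_Least[of _ "\<lambda>k. X k \<omega> \<in> A"] LeastI_ex[of "\<lambda>k. X k \<omega> \<in> A"] by blast
next
  assume k: "X k \<omega> \<in> A \<and> (\<forall>i<k. X i \<omega> \<notin> A)"
  hence "(LEAST k. X k \<omega> \<in> A) = k" by (intro Least_equality) (auto simp: not_le[symmetric])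
  thus "hitting_time X A \<omega> = enat k" using k by (auto simp: hitting_time_eq)
qed

locale discrete_chain = prob_space M for M :: "'m measure" +
  fixes X :: "nat \<Rightarrow> 'm \<Rightarrow> 'a" and p :: "'a \<Rightarrow> 'a \<Rightarrow> real" and x0 :: 'a
  assumes markov: "markov_chain M X p x0"
begin

lemma X_measurable [measurable]: "X k \<in> measurable M (count_space UNIV)"
  using markov by (simp add: markov_chain_def)

lemma in_set_measurable [measurable]: "Measurable.pred M (\<lambda>\<omega>. X k \<omega> \<in> A)"
  using measurable_sets[OF X_measurable, of A k]
  by (simp add: pred_def vimage_def Int_def conj_commute)

lemma start: "AE \<omega> in M. X 0 \<omega> = x0"
  using markov by (simp add: markov_chain_def)

lemma path_step:
  "\<P>(\<omega> in M. (\<forall>i\<le>k. X i \<omega> = xs i) \<and> X (Suc k) \<omega> = y) = \<P>(\<omega> in M. \<forall>i\<le>k. X i \<omega> = xs i) * p (xs k) y"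
  using markov unfolding markov_chain_def by blast

definition first_hit :: "'a set \<Rightarrow> nat \<Rightarrow> real" where
  "first_hit A k = \<P>(\<omega> in M. hitting_time X A \<omega> = enat k)"

lemma first_hit_measurable [measurable]: "Measurable.pred M (\<lambda>\<omega>. hitting_time X A \<omega> = enat k)"
  unfolding hitting_time_eq_enat_iff by measurable

definition discount :: "'a set \<Rightarrow> real \<Rightarrow> 'm \<Rightarrow> real" where
  "discount A a \<omega> = (case hitting_time X A \<omega> of enat k \<Rightarrow> exp (- a * real k) | \<infinity> \<Rightarrow> 0)"

lemma laplace_eq: "laplace M (hitting_time X A) a = expectation (discount A a)"
  by (simp add: laplace_def discount_def[abs_def])

lemma discount_measurable [measurable]: "discount A a \<in> borel_measurable M"
proof -
  have "discount A a = (\<lambda>\<omega>. if \<exists>k. X k \<omega> \<in> A then exp (- a * real (LEAST k. X k \<omega> \<in> A)) else 0)"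
    by (auto simp: discount_def hitting_time_eq fun_eq_iff)
  thus ?thesis by simp
qed

lemma discount_nonneg: "0 \<le> discount A a \<omega>"
  by (simp add: discount_def split: enat.split)

lemma discount_le_1: "0 \<le> a \<Longrightarrow> discount A a \<omega> \<le> 1"
  by (simp add: discount_def split: enat.split)

lemma discount_integrable: "0 \<le> a \<Longrightarrow> integrable M (discount A a)"
  by (rule integrable_const_bound[of _ 1]) (auto simp: discount_nonneg discount_le_1)

lemma laplace_nonneg: "0 \<le> laplace M (hitting_time X A) a"
  unfolding laplace_eq by (intro integral_nonneg_AE AE_I2 discount_nonneg)

lemma laplace_le_1: "0 \<le> a \<Longrightarrow> laplace M (hitting_time X A) a \<le> 1"
  unfolding laplace_eq using discount_integrable discount_le_1 by (intro integral_le_const) auto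

text \<open>
  Finite sums over the value of the hitting time suffice to bound the Laplace transform from both sides, as the times
  from \<open>m\<close> on contribute at most \<open>exp (- a) ^ m\<close>.
\<close>

lemma sum_discounted_first_hits:
  "(\<Sum>k<m. exp (- a * real k) * indicator {\<omega>\<in>space M. hitting_time X A \<omega> = enat k} \<omega>)
     = (case hitting_time X A \<omega> of enat k \<Rightarrow> if k < m then exp (- a * real k) else 0 | \<infinity> \<Rightarrow> 0)"
  if "\<omega> \<in> space M"
proof (cases "hitting_time X A \<omega>")
  case (enat j)
  have "(\<Sum>k<m. exp (- a * real k) * indicator {\<omega>\<in>space M. hitting_time X A \<omega> = enat k} \<omega>)
     = (\<Sum>k<m. if k = j then exp (- a * real j) else 0)"
    using that enat by (intro sum.cong) (auto simp: indicator_def)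
  thus ?thesis using enat by simp
qed (use that in simp)

lemma first_hit_indicator_integrable:
  "integrable M (\<lambda>\<omega>. exp (- a * real k) * indicator {\<omega>\<in>space M. hitting_time X A \<omega> = enat k} \<omega>)"
  by (intro integrable_mult_right integrable_real_indicator) (auto simp: less_top[symmetric])

lemma expectation_first_hits:
  "expectation (\<lambda>\<omega>. \<Sum>k<m. exp (- a * real k) * indicator {\<omega>\<in>space M. hitting_time X A \<omega> = enat k} \<omega>)
     = (\<Sum>k<m. exp (- a) ^ k * first_hit A k)"
proof -
  have "expectation (\<lambda>\<omega>. \<Sum>k<m. exp (- a * real k) * indicator {\<omega>\<in>space M. hitting_time X A \<omega> = enat k} \<omega>)
     = (\<Sum>k<m. expectation (\<lambda>\<omega>. exp (- a * real k) * indicator {\<omega>\<in>space M. hitting_time X A \<omega> = enat k} \<omega>))"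
    by (intro Bochner_Integration.integral_sum first_hit_indicator_integrable)
  also have "\<dots> = (\<Sum>k<m. exp (- a * real k) * first_hit A k)"
    by (intro sum.cong refl, subst integral_mult_right_zero) (simp add: first_hit_def)
  finally show ?thesis by (simp add: exp_of_nat_mult[symmetric] mult.commute)
qed

lemma laplace_ge_sum:
  assumes "0 \<le> a"
  shows "(\<Sum>k<m. exp (- a) ^ k * first_hit A k) \<le> laplace M (hitting_time X A) a"
  unfolding laplace_eq expectation_first_hits[symmetric]
proof (rule integral_mono)
  show "(\<Sum>k<m. exp (- a * real k) * indicator {\<omega>\<in>space M. hitting_time X A \<omega> = enat k} \<omega>) \<le> discount A a \<omega>"
    if "\<omega> \<in> space M" for \<omega>
    unfolding sum_discounted_first_hits[OF that] by (auto simp: discount_def split: enat.split)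
qed (intro discount_integrable assms Bochner_Integration.integrable_sum first_hit_indicator_integrable)+

lemma laplace_le_sum:
  assumes "0 \<le> a"
  shows "laplace M (hitting_time X A) a \<le> (\<Sum>k<m. exp (- a) ^ k * first_hit A k) + exp (- a) ^ m"
proof -
  let ?h = "\<lambda>\<omega>. \<Sum>k<m. exp (- a * real k) * indicator {\<omega>\<in>space M. hitting_time X A \<omega> = enat k} \<omega>"
  have int: "integrable M ?h"
    by (intro Bochner_Integration.integrable_sum first_hit_indicator_integrable)
  have "expectation (discount A a) \<le> expectation (\<lambda>\<omega>. ?h \<omega> + exp (- a) ^ m)"
  proof (rule integral_mono)
    fix \<omega> assume \<omega>: "\<omega> \<in> space M"
    have "exp (- a * real k) \<le> exp (- a) ^ m" if "m \<le> k" for k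
      using that assms by (simp add: exp_of_nat_mult[symmetric] mult.commute mult_left_mono)
    thus "discount A a \<omega> \<le> ?h \<omega> + exp (- a) ^ m"
      unfolding sum_discounted_first_hits[OF \<omega>] by (auto simp: discount_def split: enat.split)
  qed (intro discount_integrable assms Bochner_Integration.integrable_add int integrable_const)+
  also have "\<dots> = expectation ?h + exp (- a) ^ m"
    using int by (subst Bochner_Integration.integral_add) (auto simp: prob_space)
  finally show ?thesis unfolding laplace_eq expectation_first_hits .
qed

text \<open>
  Restricting the walk to a finite set \<open>W\<close> makes all sums over paths finite, even though the state space may be
  uncountable.
\<close>

definition occupation :: "'a set \<Rightarrow> nat \<Rightarrow> 'a \<Rightarrow> real" where
  "occupation W k x = \<P>(\<omega> in M. (\<forall>i\<le>k. X i \<omega> \<in> W) \<and> X k \<omega> = x)"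

lemma occupation_nonneg: "0 \<le> occupation W k x"
  by (simp add: occupation_def)

lemma occupation_0: "occupation W 0 x = (if x \<in> W \<and> x = x0 then 1 else 0)"
proof (cases "x \<in> W \<and> x = x0")
  case True
  have "prob {\<omega>\<in>space M. X 0 \<omega> \<in> W \<and> X 0 \<omega> = x} = 1"
    using start True by (subst prob_Collect_eq_1) auto
  moreover have "occupation W 0 x = prob {\<omega>\<in>space M. X 0 \<omega> \<in> W \<and> X 0 \<omega> = x}"
    by (simp add: occupation_def)
  ultimately show ?thesis using True by auto
next
  case False
  have "prob {\<omega>\<in>space M. X 0 \<omega> \<in> W \<and> X 0 \<omega> = x} = 0"
    using start False by (subst prob_Collect_eq_0) auto
  thus ?thesis using False by (auto simp: occupation_def)
qed

lemma occupation_step: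
  assumes W: "finite W" "x \<in> W"
  shows "\<P>(\<omega> in M. (\<forall>i\<le>k. X i \<omega> \<in> W) \<and> X k \<omega> = x \<and> X (Suc k) \<omega> = y) = occupation W k x * p x y"
proof -
  define I where "I = {xs \<in> PiE {..k} (\<lambda>_. W). xs k = x}"
  have fin: "finite I" unfolding I_def using W by (auto intro: finite_subset[OF _ finite_PiE[of "{..k}" "\<lambda>_. W"]])
  have xs_k: "xs k = x" if "xs \<in> I" for xs using that by (simp add: I_def)
  have path: "((\<forall>i\<le>k. X i \<omega> \<in> W) \<and> X k \<omega> = x) \<longleftrightarrow> (\<exists>xs\<in>I. \<forall>i\<le>k. X i \<omega> = xs i)" for \<omega>
  proof
    assume "(\<forall>i\<le>k. X i \<omega> \<in> W) \<and> X k \<omega> = x"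
    hence "restrict (\<lambda>i. X i \<omega>) {..k} \<in> I" by (auto simp: I_def)
    thus "\<exists>xs\<in>I. \<forall>i\<le>k. X i \<omega> = xs i" by (intro bexI[of _ "restrict (\<lambda>i. X i \<omega>) {..k}"]) auto
  next
    assume "\<exists>xs\<in>I. \<forall>i\<le>k. X i \<omega> = xs i"
    thus "(\<forall>i\<le>k. X i \<omega> \<in> W) \<and> X k \<omega> = x" by (auto simp: I_def PiE_iff)
  qed
  have distinct: "xs = ys" if "xs \<in> I" "ys \<in> I" "\<forall>i\<le>k. X i \<omega> = xs i" "\<forall>i\<le>k. X i \<omega> = ys i" for xs ys \<omega>
    using that by (intro PiE_ext[of xs "{..k}" "\<lambda>_. W" ys]) (auto simp: I_def)
  have split: "\<P>(\<omega> in M. (\<forall>i\<le>k. X i \<omega> \<in> W) \<and> X k \<omega> = x \<and> Q \<omega>)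
      = (\<Sum>xs\<in>I. \<P>(\<omega> in M. (\<forall>i\<le>k. X i \<omega> = xs i) \<and> Q \<omega>))"
    if [measurable]: "Measurable.pred M Q" for Q
  proof -
    have "{\<omega>\<in>space M. (\<forall>i\<le>k. X i \<omega> \<in> W) \<and> X k \<omega> = x \<and> Q \<omega>}
        = (\<Union>xs\<in>I. {\<omega>\<in>space M. (\<forall>i\<le>k. X i \<omega> = xs i) \<and> Q \<omega>})"
      using path by blast
    thus ?thesis
      using fin distinct by (simp only:) (rule finite_measure_finite_Union, auto simp: disjoint_family_on_def)
  qed
  have "\<P>(\<omega> in M. (\<forall>i\<le>k. X i \<omega> \<in> W) \<and> X k \<omega> = x \<and> X (Suc k) \<omega> = y)
      = (\<Sum>xs\<in>I. \<P>(\<omega> in M. \<forall>i\<le>k. X i \<omega> = xs i) * p x y)"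
    by (subst split) (auto simp: path_step xs_k intro!: sum.cong)
  also have "\<dots> = (\<Sum>xs\<in>I. \<P>(\<omega> in M. \<forall>i\<le>k. X i \<omega> = xs i)) * p x y" by (rule sum_distrib_right[symmetric])
  also have "(\<Sum>xs\<in>I. \<P>(\<omega> in M. \<forall>i\<le>k. X i \<omega> = xs i)) = occupation W k x"
    using split[of "\<lambda>_. True"] by (simp add: occupation_def)
  finally show ?thesis .
qed

lemma sum_over_states:
  assumes W: "finite W" and [measurable]: "Measurable.pred M Q"
  shows "\<P>(\<omega> in M. (\<forall>i\<le>k. X i \<omega> \<in> W) \<and> Q \<omega>) = (\<Sum>x\<in>W. \<P>(\<omega> in M. (\<forall>i\<le>k. X i \<omega> \<in> W) \<and> X k \<omega> = x \<and> Q \<omega>))"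
proof -
  have "{\<omega>\<in>space M. (\<forall>i\<le>k. X i \<omega> \<in> W) \<and> Q \<omega>}
      = (\<Union>x\<in>W. {\<omega>\<in>space M. (\<forall>i\<le>k. X i \<omega> \<in> W) \<and> X k \<omega> = x \<and> Q \<omega>})"
    by auto
  thus ?thesis
    using W by (simp only:) (rule finite_measure_finite_Union, auto simp: disjoint_family_on_def)
qed

lemma survival_eq:
  assumes W: "finite W"
  shows "\<P>(\<omega> in M. \<forall>i\<le>k. X i \<omega> \<in> W) = (\<Sum>x\<in>W. occupation W k x)"
  using sum_over_states[OF W, of "\<lambda>_. True" k] by (simp add: occupation_def)

lemma next_state:
  assumes W: "finite W"
  shows "\<P>(\<omega> in M. (\<forall>i\<le>k. X i \<omega> \<in> W) \<and> X (Suc k) \<omega> = y) = (\<Sum>x\<in>W. occupation W k x * p x y)"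
  using W by (subst sum_over_states) (auto simp: occupation_step intro!: sum.cong)

lemma next_state_in:
  assumes W: "finite W" and F: "finite F"
  shows "\<P>(\<omega> in M. (\<forall>i\<le>k. X i \<omega> \<in> W) \<and> X (Suc k) \<omega> \<in> F) = (\<Sum>x\<in>W. occupation W k x * (\<Sum>y\<in>F. p x y))"
proof -
  have "{\<omega>\<in>space M. (\<forall>i\<le>k. X i \<omega> \<in> W) \<and> X (Suc k) \<omega> \<in> F}
      = (\<Union>y\<in>F. {\<omega>\<in>space M. (\<forall>i\<le>k. X i \<omega> \<in> W) \<and> X (Suc k) \<omega> = y})"
    by auto
  hence "\<P>(\<omega> in M. (\<forall>i\<le>k. X i \<omega> \<in> W) \<and> X (Suc k) \<omega> \<in> F)
      = (\<Sum>y\<in>F. \<P>(\<omega> in M. (\<forall>i\<le>k. X i \<omega> \<in> W) \<and> X (Suc k) \<omega> = y))"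
    using F by (simp only:) (rule finite_measure_finite_Union, auto simp: disjoint_family_on_def)
  also have "\<dots> = (\<Sum>y\<in>F. \<Sum>x\<in>W. occupation W k x * p x y)" by (simp add: next_state[OF W])
  also have "\<dots> = (\<Sum>x\<in>W. occupation W k x * (\<Sum>y\<in>F. p x y))"
    by (subst sum.swap) (simp add: sum_distrib_left)
  finally show ?thesis .
qed

lemma occupation_Suc:
  assumes W: "finite W"
  shows "occupation W (Suc k) y = (if y \<in> W then \<Sum>x\<in>W. occupation W k x * p x y else 0)"
proof (cases "y \<in> W")
  case True
  have "{\<omega>\<in>space M. (\<forall>i\<le>Suc k. X i \<omega> \<in> W) \<and> X (Suc k) \<omega> = y}
      = {\<omega>\<in>space M. (\<forall>i\<le>k. X i \<omega> \<in> W) \<and> X (Suc k) \<omega> = y}"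
    using True by (auto simp: le_Suc_eq)
  thus ?thesis using True next_state[OF W, of k y] by (simp add: occupation_def)
next
  case False
  hence "{\<omega>\<in>space M. (\<forall>i\<le>Suc k. X i \<omega> \<in> W) \<and> X (Suc k) \<omega> = y} = {}" by auto
  thus ?thesis using False by (simp only: occupation_def) simp
qed

lemma first_hit_start: "x0 \<in> A \<Longrightarrow> first_hit A 0 = 1"
  using start unfolding first_hit_def hitting_time_eq_enat_iff
  by (subst prob_Collect_eq_1) auto

lemma first_hit_0: "x0 \<notin> A \<Longrightarrow> first_hit A 0 = 0"
  using start unfolding first_hit_def hitting_time_eq_enat_iff
  by (subst prob_Collect_eq_0) auto

end

section \<open>Transform bounds for the two walks\<close>

context discrete_chain begin

lemma laplace_antimono:
  assumes "0 \<le> a" "a \<le> a'"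
  shows "laplace M (hitting_time X A) a' \<le> laplace M (hitting_time X A) a"
  unfolding laplace_eq
proof (rule integral_mono)
  show "discount A a' \<omega> \<le> discount A a \<omega>" for \<omega>
    using assms by (auto simp: discount_def mult_right_mono split: enat.split)
qed (use assms in \<open>auto intro!: discount_integrable\<close>)

lemma laplace_plus_1:
  "laplace M (\<lambda>\<omega>. hitting_time X A \<omega> + 1) a = exp (- a) * laplace M (hitting_time X A) a"
proof -
  have "(case hitting_time X A \<omega> + 1 of enat k \<Rightarrow> exp (- a * real k) | \<infinity> \<Rightarrow> 0) = exp (- a) * discount A a \<omega>" for \<omega>
    by (cases "hitting_time X A \<omega>") (auto simp: discount_def one_enat_def exp_add[symmetric] algebra_simps)
  thus ?thesis unfolding laplace_eq by (simp add: laplace_def)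
qed

lemma first_hit_ge:
  assumes "finite W" "W \<inter> A = {}" "y \<in> A"
  shows "(\<Sum>x\<in>W. occupation W k x * p x y) \<le> first_hit A (Suc k)"
  unfolding next_state[OF assms(1), symmetric] first_hit_def hitting_time_eq_enat_iff
  using assms by (intro finite_measure_mono) (auto simp: less_Suc_eq_le)

end

text \<open>
  The case \<open>g = 1\<close> is the symmetric walk; for \<open>g < 1\<close> the walk need not reach \<open>n\<close>.
\<close>

locale biased_walk = discrete_chain N S "biased_prob g" 0
  for N :: "'k measure" and S :: "nat \<Rightarrow> 'k \<Rightarrow> int" and g :: real +
  assumes g: "1 \<le> g"
begin

lemma biased_sum:
  assumes "finite F" "x + 1 \<in> F" "x - 1 \<in> F"
  shows "(\<Sum>y\<in>F. biased_prob g x y * \<phi> y) = g / (g + 1) * \<phi> (x + 1) + 1 / (g + 1) * \<phi> (x - 1)"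
proof -
  have "(\<Sum>y\<in>F. biased_prob g x y * \<phi> y) = (\<Sum>y\<in>{x + 1, x - 1}. biased_prob g x y * \<phi> y)"
    using assms by (intro sum.mono_neutral_right) (auto simp: biased_prob_def)
  thus ?thesis by (simp add: biased_prob_def)
qed

lemma occupation_eq_0_below: "finite W \<Longrightarrow> x < - int k \<Longrightarrow> occupation W k x = 0"
proof (induction k arbitrary: x)
  case (Suc k)
  have "occupation W k y * biased_prob g y x = 0" for y
    using Suc.IH[OF Suc.prems(1), of y] Suc.prems(2)
    by (cases "y < - int k") (auto simp: biased_prob_def)
  hence "(\<Sum>y\<in>W. occupation W k y * biased_prob g y x) = 0" by (intro sum.neutral ballI)
  thus ?case using occupation_Suc[OF Suc.prems(1), of k x] by (simp split: if_splits)
qed (simp add: occupation_0)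

text \<open>
  The hypothesis \<open>(g + 1) * h \<le> s * (g + h\<^sup>2)\<close> makes \<open>s ^ k * h powi (n - S\<^sub>k)\<close> a submartingale up to the hitting
  time of \<open>n\<close>; the right-hand side is its expectation at the minimum of \<open>k\<close> and that time. The walk cannot leave \<open>W\<close>
  on the left within \<open>K\<close> steps, so the finite set loses nothing.
\<close>

lemma submartingale_bound:
  assumes n: "1 \<le> n" and h: "0 < h" "h \<le> 1" and s: "0 \<le> s" and sub: "(g + 1) * h \<le> s * (g + h\<^sup>2)"
    and "k \<le> K"
  defines "W \<equiv> {- int K..int n - 1}"
  shows "h ^ n \<le> (\<Sum>j<Suc k. s ^ j * first_hit {int n} j) + s ^ k * (\<Sum>x\<in>W. occupation W k x * h ^ nat (int n - x))"
  using \<open>k \<le> K\<close>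
proof (induction k)
  case 0
  have "0 \<in> W" using n by (auto simp: W_def)
  moreover have "(\<Sum>x\<in>W. occupation W 0 x * h ^ nat (int n - x)) = (\<Sum>x\<in>W. if x = 0 then h ^ n else 0)"
    by (intro sum.cong) (auto simp: occupation_0)
  moreover have "finite W" by (simp add: W_def)
  ultimately show ?case by (simp add: first_hit_def)
next
  case (Suc k)
  define \<phi> where "\<phi> x = h ^ nat (int n - x)" for x
  have fin: "finite W" by (simp add: W_def)
  have n_W: "int n \<notin> W" by (simp add: W_def)
  have "(\<Sum>x\<in>W. occupation W k x * \<phi> x) \<le> (\<Sum>x\<in>W. occupation W k x * (s * (\<Sum>y\<in>insert (int n) W. biased_prob g x y * \<phi> y)))"
  proof (intro sum_mono)
    fix x assume x: "x \<in> W"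
    show "occupation W k x * \<phi> x \<le> occupation W k x * (s * (\<Sum>y\<in>insert (int n) W. biased_prob g x y * \<phi> y))"
    proof (cases "x < - int k")
      case True
      thus ?thesis by (simp add: occupation_eq_0_below[OF fin])
    next
      case False
      define m where "m = nat (int n - x - 1)"
      have m: "nat (int n - x) = Suc m" "nat (int n - (x + 1)) = m" "nat (int n - (x - 1)) = Suc (Suc m)"
        using x by (auto simp: W_def m_def)
      have "(\<Sum>y\<in>insert (int n) W. biased_prob g x y * \<phi> y) = g / (g + 1) * \<phi> (x + 1) + 1 / (g + 1) * \<phi> (x - 1)"
        using x False Suc.prems by (intro biased_sum) (auto simp: W_def)
      also have "\<dots> = h ^ m * (g + h\<^sup>2) / (g + 1)"
      proof -
        have \<phi>: "\<phi> (x + 1) = h ^ m" "\<phi> (x - 1) = h ^ m * h\<^sup>2"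
          by (simp_all only: \<phi>_def m) (simp add: power2_eq_square)
        show ?thesis unfolding \<phi> by (simp add: add_divide_distrib distrib_left mult_ac)
      qed
      finally have "s * (\<Sum>y\<in>insert (int n) W. biased_prob g x y * \<phi> y) = h ^ m * (s * (g + h\<^sup>2) / (g + 1))"
        by (simp add: mult_ac)
      moreover have "h ^ m * h \<le> h ^ m * (s * (g + h\<^sup>2) / (g + 1))"
        using h g sub by (intro mult_left_mono) (auto simp: pos_le_divide_eq mult.commute)
      moreover have "\<phi> x = h ^ m * h" by (simp add: \<phi>_def m)
      ultimately show ?thesis using occupation_nonneg[of W k x] by (intro mult_left_mono) auto
    qed
  qed
  also have "\<dots> = s * (\<Sum>y\<in>insert (int n) W. (\<Sum>x\<in>W. occupation W k x * biased_prob g x y) * \<phi> y)"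
    by (subst sum_distrib_right, subst sum.swap) (simp add: sum_distrib_left mult_ac)
  also have "\<dots> = s * ((\<Sum>x\<in>W. occupation W k x * biased_prob g x (int n)) + (\<Sum>y\<in>W. occupation W (Suc k) y * \<phi> y))"
    using fin n_W by (simp add: occupation_Suc \<phi>_def)
  also have "\<dots> \<le> s * (first_hit {int n} (Suc k) + (\<Sum>y\<in>W. occupation W (Suc k) y * \<phi> y))"
    using s fin n_W by (intro mult_left_mono add_right_mono first_hit_ge) auto
  finally have "s ^ k * (\<Sum>x\<in>W. occupation W k x * \<phi> x)
      \<le> s ^ k * (s * (first_hit {int n} (Suc k) + (\<Sum>y\<in>W. occupation W (Suc k) y * \<phi> y)))"
    using s by (intro mult_left_mono) auto
  thus ?case using Suc by (simp add: \<phi>_def algebra_simps)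
qed

lemma laplace_ge_power:
  assumes n: "1 \<le> n" and h: "0 < h" "h \<le> 1" and a: "0 < a" and sub: "(g + 1) * h \<le> exp (- a) * (g + h\<^sup>2)"
  shows "h ^ n \<le> laplace N (hitting_time S {int n}) a"
proof (rule tendsto_upperbound)
  show "(\<lambda>K. h ^ n - exp (- a) ^ K) \<longlonglongrightarrow> h ^ n"
    using a by (auto intro!: tendsto_eq_intros LIMSEQ_realpow_zero)
  show "\<forall>\<^sub>F K in sequentially. h ^ n - exp (- a) ^ K \<le> laplace N (hitting_time S {int n}) a"
  proof (intro always_eventually allI)
    fix K
    let ?W = "{- int K..int n - 1}"
    have "(\<Sum>x\<in>?W. occupation ?W K x * h ^ nat (int n - x)) \<le> (\<Sum>x\<in>?W. occupation ?W K x * 1)"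
      using h by (intro sum_mono mult_left_mono occupation_nonneg power_le_one) auto
    also have "\<dots> = \<P>(\<omega> in N. \<forall>i\<le>K. S i \<omega> \<in> ?W)" by (subst survival_eq) auto
    also have "\<dots> \<le> 1" by (rule prob_le_1)
    finally have "exp (- a) ^ K * (\<Sum>x\<in>?W. occupation ?W K x * h ^ nat (int n - x)) \<le> exp (- a) ^ K * 1"
      by (intro mult_left_mono) auto
    moreover have "h ^ n \<le> (\<Sum>j<Suc K. exp (- a) ^ j * first_hit {int n} j)
        + exp (- a) ^ K * (\<Sum>x\<in>?W. occupation ?W K x * h ^ nat (int n - x))"
      using n h sub by (intro submartingale_bound) auto
    moreover have "(\<Sum>j<Suc K. exp (- a) ^ j * first_hit {int n} j) \<le> laplace N (hitting_time S {int n}) a"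
      using a by (intro laplace_ge_sum) auto
    ultimately show "h ^ n - exp (- a) ^ K \<le> laplace N (hitting_time S {int n}) a" by linarith
  qed
qed auto

text \<open>
  The walk reaches \<open>n\<close> almost surely: for every \<open>h < 1\<close> there is some \<open>s < 1\<close> as in \<open>laplace_ge_power\<close>, so the
  probability is at least \<open>h ^ n\<close>.
\<close>

lemma laplace_0_ge_1:
  assumes n: "1 \<le> n"
  shows "1 \<le> laplace N (hitting_time S {int n}) 0"
proof (rule tendsto_upperbound)
  have "((\<lambda>h. h ^ n) \<longlongrightarrow> 1 ^ n) (at_left (1::real))" by (intro tendsto_intros)
  thus "((\<lambda>h. h ^ n) \<longlongrightarrow> 1) (at_left (1::real))" by simp
  show "\<forall>\<^sub>F h in at_left 1. h ^ n \<le> laplace N (hitting_time S {int n}) 0"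
    using eventually_at_left_real[of 0 1, OF zero_less_one]
  proof eventually_elim
    case (elim h)
    hence h: "0 < h" "h < 1" by auto
    define s where "s = (g + 1) * h / (g + h\<^sup>2)"
    have pos: "0 < g + h\<^sup>2" using g by (simp add: add_pos_nonneg)
    have "0 < (1 - h) * (g - h)" using h g by (intro mult_pos_pos) auto
    hence "(g + 1) * h < g + h\<^sup>2" by (simp add: algebra_simps power2_eq_square)
    hence s: "0 < s" "s < 1" using pos h g by (auto simp: s_def)
    have "h ^ n \<le> laplace N (hitting_time S {int n}) (- ln s)"
      using n h s pos by (intro laplace_ge_power) (auto simp: s_def)
    also have "\<dots> \<le> laplace N (hitting_time S {int n}) 0"
      using s by (intro laplace_antimono) auto
    finally show ?case .
  qed
qed auto

end

locale graph_walk = graph_target V w x0 z + discrete_chain M X "walk_prob V w" x0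
  for V :: "'a set" and w :: "'a \<Rightarrow> 'a \<Rightarrow> real" and x0 :: 'a and z :: "'a set"
    and M :: "'m measure" and X :: "nat \<Rightarrow> 'm \<Rightarrow> 'a"
begin

lemma walk_prob_tendsto:
  assumes x: "x \<in> V" and A: "A \<subseteq> V"
  shows "((\<lambda>F. \<Sum>y\<in>F. walk_prob V w x y) \<longlongrightarrow> (\<Sum>\<^sub>\<infinity>y\<in>A. w x y) / vertex_weight V w x) (finite_subsets_at_top A)"
proof -
  have "((\<lambda>F. (\<Sum>y\<in>F. w x y) / vertex_weight V w x) \<longlongrightarrow> (\<Sum>\<^sub>\<infinity>y\<in>A. w x y) / vertex_weight V w x)
      (finite_subsets_at_top A)"
    using vertex_weight_pos[OF x] summable_on_subset_banach[OF weight_summable[OF x] A]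
    by (intro tendsto_divide tendsto_const infsum_tendsto) auto
  moreover have "\<forall>\<^sub>F F in finite_subsets_at_top A.
      (\<Sum>y\<in>F. w x y) / vertex_weight V w x = (\<Sum>y\<in>F. walk_prob V w x y)"
    using x A by (intro eventually_finite_subsets_at_top_weakI)
      (auto simp: sum_divide_distrib walk_prob_def intro!: sum.cong)
  ultimately show ?thesis by (rule Lim_transform_eventually)
qed

text \<open>
  The target may be uncountable, so the probability of entering it is bounded through the complement, as the limit of one
  minus the probability to stay in a finite set off \<open>z\<close>.
\<close>

lemma exit_prob_le:
  assumes W: "finite W" "W \<subseteq> V - z"
  shows "\<P>(\<omega> in M. (\<forall>i\<le>k. X i \<omega> \<in> W) \<and> X (Suc k) \<omega> \<in> z)
    \<le> (\<Sum>x\<in>W. occupation W k x * (into_z x / vertex_weight V w x))"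
proof (rule tendsto_lowerbound)
  show "((\<lambda>F. \<Sum>x\<in>W. occupation W k x * (1 - (\<Sum>y\<in>F. walk_prob V w x y)))
      \<longlongrightarrow> (\<Sum>x\<in>W. occupation W k x * (into_z x / vertex_weight V w x))) (finite_subsets_at_top (V - z))"
  proof (intro tendsto_sum tendsto_mult tendsto_const)
    fix x assume "x \<in> W"
    hence x: "x \<in> V" using W by auto
    have "vertex_weight V w x = (\<Sum>\<^sub>\<infinity>y\<in>(V - z) \<union> z. w x y)"
      using z_V by (simp add: vertex_weight_def Un_absorb2)
    also have "\<dots> = (\<Sum>\<^sub>\<infinity>y\<in>V - z. w x y) + into_z x"
      unfolding into_z_def
      by (intro infsum_Un_disjoint summable_z x summable_on_subset_banach[OF weight_summable[OF x]]) auto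
    finally have "into_z x / vertex_weight V w x = 1 - (\<Sum>\<^sub>\<infinity>y\<in>V - z. w x y) / vertex_weight V w x"
      using vertex_weight_pos[OF x] by (simp add: field_simps)
    moreover have "((\<lambda>F. 1 - (\<Sum>y\<in>F. walk_prob V w x y)) \<longlongrightarrow>
        1 - (\<Sum>\<^sub>\<infinity>y\<in>V - z. w x y) / vertex_weight V w x) (finite_subsets_at_top (V - z))"
      using x by (intro tendsto_diff tendsto_const walk_prob_tendsto) auto
    ultimately show "((\<lambda>F. 1 - (\<Sum>y\<in>F. walk_prob V w x y)) \<longlongrightarrow> into_z x / vertex_weight V w x)
      (finite_subsets_at_top (V - z))" by simp
  qed
  show "\<forall>\<^sub>F F in finite_subsets_at_top (V - z).
      \<P>(\<omega> in M. (\<forall>i\<le>k. X i \<omega> \<in> W) \<and> X (Suc k) \<omega> \<in> z)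
      \<le> (\<Sum>x\<in>W. occupation W k x * (1 - (\<Sum>y\<in>F. walk_prob V w x y)))"
  proof (rule eventually_finite_subsets_at_top_weakI)
    fix F assume F: "finite F" "F \<subseteq> V - z"
    let ?A = "{\<omega>\<in>space M. (\<forall>i\<le>k. X i \<omega> \<in> W) \<and> X (Suc k) \<omega> \<in> z}"
    let ?B = "{\<omega>\<in>space M. (\<forall>i\<le>k. X i \<omega> \<in> W) \<and> X (Suc k) \<omega> \<in> F}"
    have "prob ?A + prob ?B = prob (?A \<union> ?B)"
      using F by (intro finite_measure_Union[symmetric]) auto
    also have "\<dots> \<le> \<P>(\<omega> in M. \<forall>i\<le>k. X i \<omega> \<in> W)"
      by (intro finite_measure_mono) auto
    also have "\<dots> = (\<Sum>x\<in>W. occupation W k x)" by (rule survival_eq[OF W(1)])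
    finally show "prob ?A \<le> (\<Sum>x\<in>W. occupation W k x * (1 - (\<Sum>y\<in>F. walk_prob V w x y)))"
      unfolding next_state_in[OF W(1) F(1)] by (simp add: right_diff_distrib sum_subtractf)
  qed
qed auto

text \<open>
  Since the transition probabilities from each vertex sum to one, finitely many successors of each of finitely many
  vertices carry all but a small part of the next step.
\<close>

lemma tightness:
  assumes "0 < \<epsilon>"
  shows "\<exists>W. finite W \<and> W \<subseteq> V \<and> x0 \<in> W \<and> 1 - \<epsilon> < \<P>(\<omega> in M. \<forall>i\<le>k. X i \<omega> \<in> W)"
proof (induction k)
  case 0
  have "\<P>(\<omega> in M. \<forall>i\<le>0. X i \<omega> \<in> {x0}) = 1"
    by (subst survival_eq) (auto simp: occupation_0)
  thus ?case using assms x0_V by (intro exI[of _ "{x0}"]) auto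
next
  case (Suc k)
  then obtain W where W: "finite W" "W \<subseteq> V" "x0 \<in> W" "1 - \<epsilon> < \<P>(\<omega> in M. \<forall>i\<le>k. X i \<omega> \<in> W)" by blast
  have "((\<lambda>F. \<Sum>x\<in>W. occupation W k x * (\<Sum>y\<in>F. walk_prob V w x y)) \<longlongrightarrow> (\<Sum>x\<in>W. occupation W k x * 1))
      (finite_subsets_at_top V)"
  proof (intro tendsto_sum tendsto_mult tendsto_const)
    fix x assume "x \<in> W"
    thus "((\<lambda>F. \<Sum>y\<in>F. walk_prob V w x y) \<longlongrightarrow> 1) (finite_subsets_at_top V)"
      using walk_prob_tendsto[of x V] vertex_weight_pos[of x] W(2) by (auto simp: vertex_weight_def)
  qed
  moreover have "1 - \<epsilon> < (\<Sum>x\<in>W. occupation W k x * 1)" using W by (simp add: survival_eq)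
  ultimately have "\<forall>\<^sub>F F in finite_subsets_at_top V. 1 - \<epsilon> < (\<Sum>x\<in>W. occupation W k x * (\<Sum>y\<in>F. walk_prob V w x y))"
    by (rule order_tendstoD)
  then obtain F where F: "finite F" "F \<subseteq> V" "1 - \<epsilon> < (\<Sum>x\<in>W. occupation W k x * (\<Sum>y\<in>F. walk_prob V w x y))"
    unfolding eventually_finite_subsets_at_top by blast
  have "1 - \<epsilon> < \<P>(\<omega> in M. (\<forall>i\<le>k. X i \<omega> \<in> W) \<and> X (Suc k) \<omega> \<in> F)"
    unfolding next_state_in[OF W(1) F(1)] by (rule F(3))
  also have "\<dots> \<le> \<P>(\<omega> in M. \<forall>i\<le>Suc k. X i \<omega> \<in> W \<union> F)"
    by (intro finite_measure_mono) (auto simp: le_Suc_eq)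
  finally show ?case using W F by (intro exI[of _ "W \<union> F"]) auto
qed

lemma sum_exit_prob_le_hit:
  assumes W: "finite W" "W \<subseteq> V - z" "x0 \<in> W" and s: "0 < s" "s < 1"
  shows "(\<Sum>k<m. s ^ Suc k * \<P>(\<omega> in M. (\<forall>i\<le>k. X i \<omega> \<in> W) \<and> X (Suc k) \<omega> \<in> z))
    \<le> killed_network.hit W w (vertex_weight V w) into_z s x0"
proof -
  interpret killed_network W w "vertex_weight V w" into_z x0 by (rule killed_network[OF W])
  let ?\<psi> = "\<lambda>x. (if x = x0 then 1 else 0) / vertex_weight V w x"
  have s': "\<bar>s\<bar> < 1" using s by simp
  have occ: "occupation W k x = vertex_weight V w x * iterate ?\<psi> k x" if "x \<in> W" for k x
    using that
  proof (induction k arbitrary: x)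
    case 0
    thus ?case using wt_pos[of x] by (auto simp: occupation_0)
  next
    case (Suc k)
    have "occupation W (Suc k) x = (\<Sum>y\<in>W. w x y * iterate ?\<psi> k y)"
      unfolding occupation_Suc[OF W(1)] if_P[OF Suc.prems]
    proof (intro sum.cong refl)
      fix y assume y: "y \<in> W"
      have "occupation W k y * walk_prob V w y x
          = vertex_weight V w y * iterate ?\<psi> k y * (w y x / vertex_weight V w y)"
        using Suc y W by (auto simp: walk_prob_def)
      thus "occupation W k y * walk_prob V w y x = w x y * iterate ?\<psi> k y"
        using wt_pos[OF y] w_sym[OF y Suc.prems] by simp
    qed
    thus ?case using wt_pos[OF Suc.prems] by simp
  qed
  have "(\<Sum>k<m. s ^ Suc k * \<P>(\<omega> in M. (\<forall>i\<le>k. X i \<omega> \<in> W) \<and> X (Suc k) \<omega> \<in> z))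
      \<le> (\<Sum>k<m. s ^ Suc k * (\<Sum>x\<in>W. occupation W k x * (into_z x / vertex_weight V w x)))"
    using s W by (intro sum_mono mult_left_mono exit_prob_le) auto
  also have "\<dots> = (\<Sum>k<m. \<Sum>x\<in>W. s * into_z x * (iterate ?\<psi> k x * s ^ k))"
    unfolding sum_distrib_left
  proof (intro sum.cong refl)
    fix k x assume x: "x \<in> W"
    show "s ^ Suc k * (occupation W k x * (into_z x / vertex_weight V w x)) = s * into_z x * (iterate ?\<psi> k x * s ^ k)"
      using wt_pos[OF x] by (simp add: occ[OF x])
  qed
  also have "\<dots> = (\<Sum>x\<in>W. s * into_z x * (\<Sum>k<m. iterate ?\<psi> k x * s ^ k))"
    by (subst sum.swap) (simp add: sum_distrib_left)
  also have "\<dots> \<le> (\<Sum>x\<in>W. s * into_z x * green s x)"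
    unfolding green_def neumann_def
    using s s' b_nonneg
    by (intro sum_mono mult_left_mono sum_le_suminf neumann_summable mult_nonneg_nonneg iterate_nonneg src_rate_nonneg)
       auto
  also have "\<dots> = (\<Sum>x\<in>W. green s x * (s * into_z x))" by (simp add: mult_ac)
  also have "\<dots> = hit s x0"
    by (rule green_pairing[OF s', symmetric]) (simp add: hit_eq[OF _ s'] distrib_left)
  finally show ?thesis .
qed

lemma laplace_le_hit:
  assumes a: "0 < a" and \<delta>: "0 < \<delta>"
  shows "\<exists>W. finite W \<and> W \<subseteq> V - z \<and> x0 \<in> W \<and>
    laplace M (hitting_time X z) a \<le> killed_network.hit W w (vertex_weight V w) into_z (exp (- a)) x0 + \<delta>"
proof -
  define s where "s = exp (- a)"
  have s: "0 < s" "s < 1" using a by (auto simp: s_def)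
  have "(\<lambda>m. s ^ Suc m) \<longlonglongrightarrow> 0" using s by (intro LIMSEQ_Suc LIMSEQ_realpow_zero) auto
  hence "\<forall>\<^sub>F m in sequentially. s ^ Suc m < \<delta> / 2" using \<delta> by (intro order_tendstoD) auto
  then obtain m where m: "s ^ Suc m < \<delta> / 2" unfolding eventually_sequentially by blast
  define \<epsilon> where "\<epsilon> = \<delta> / (2 * (real m + 1))"
  have \<epsilon>: "0 < \<epsilon>" "real m * \<epsilon> \<le> \<delta> / 2" using \<delta> by (auto simp: \<epsilon>_def field_simps)
  obtain W0 where W0: "finite W0" "W0 \<subseteq> V" "x0 \<in> W0" "1 - \<epsilon> < \<P>(\<omega> in M. \<forall>i\<le>m. X i \<omega> \<in> W0)"
    using tightness[OF \<epsilon>(1), of m] by blast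
  define W where "W = W0 - z"
  have W: "finite W" "W \<subseteq> V - z" "x0 \<in> W" using W0 x0_z by (auto simp: W_def)
  let ?e = "\<lambda>k. \<P>(\<omega> in M. (\<forall>i\<le>k. X i \<omega> \<in> W) \<and> X (Suc k) \<omega> \<in> z)"
  have step: "s ^ Suc k * first_hit z (Suc k) \<le> s ^ Suc k * ?e k + \<epsilon>" if k: "k < m" for k
  proof -
    let ?A = "{\<omega>\<in>space M. (\<forall>i\<le>k. X i \<omega> \<in> W) \<and> X (Suc k) \<omega> \<in> z}"
    let ?G = "{\<omega>\<in>space M. \<forall>i\<le>m. X i \<omega> \<in> W0}"
    have "first_hit z (Suc k) \<le> prob (?A \<union> (space M - ?G))"
      unfolding first_hit_def hitting_time_eq_enat_iff using k
      by (intro finite_measure_mono) (auto simp: W_def less_Suc_eq_le)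
    also have "\<dots> \<le> prob ?A + prob (space M - ?G)"
      by (intro measure_Un_le) auto
    also have "prob (space M - ?G) \<le> \<epsilon>"
      using W0(4) by (subst prob_compl) auto
    finally have "s ^ Suc k * first_hit z (Suc k) \<le> s ^ Suc k * (?e k + \<epsilon>)"
      using s by (intro mult_left_mono) auto
    also have "\<dots> \<le> s ^ Suc k * ?e k + 1 * \<epsilon>"
      unfolding distrib_left using s \<epsilon> by (intro add_left_mono mult_right_mono power_le_one) auto
    finally show ?thesis by simp
  qed
  have "laplace M (hitting_time X z) a \<le> (\<Sum>k<Suc m. s ^ k * first_hit z k) + s ^ Suc m"
    unfolding s_def using a by (intro laplace_le_sum) auto
  also have "(\<Sum>k<Suc m. s ^ k * first_hit z k) = (\<Sum>k<m. s ^ Suc k * first_hit z (Suc k))"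
    using first_hit_0[OF x0_z] by (subst sum.lessThan_Suc_shift) simp
  also have "\<dots> \<le> (\<Sum>k<m. s ^ Suc k * ?e k + \<epsilon>)" using step by (intro sum_mono) auto
  also have "\<dots> = (\<Sum>k<m. s ^ Suc k * ?e k) + real m * \<epsilon>" by (simp add: sum.distrib)
  also have "(\<Sum>k<m. s ^ Suc k * ?e k) \<le> killed_network.hit W w (vertex_weight V w) into_z s x0"
    by (rule sum_exit_prob_le_hit[OF W s])
  finally have "laplace M (hitting_time X z) a \<le> killed_network.hit W w (vertex_weight V w) into_z s x0 + \<delta>"
    using m \<epsilon> by linarith
  thus ?thesis using W unfolding s_def by blast
qed

end

section \<open>Comparison of the two hitting times\<close>

text \<open>
  The graph distance from \<open>x0\<close>, cut off at \<open>n\<close>. A vertex adjacent to \<open>z\<close> has distance at least \<open>n\<close>, as otherwise \<open>z\<close>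
  could be reached in \<open>n\<close> steps.
\<close>

lemma (in graph_target) distance_profile:
  assumes far: "enat (n + 1) \<le> graph_dist V w x0 z" and n: "1 \<le> n"
  obtains d :: "'a \<Rightarrow> real" where
    "d x0 = 0"
    "\<And>x y. x \<in> V \<Longrightarrow> y \<in> V \<Longrightarrow> 0 < w x y \<Longrightarrow> \<bar>d y - d x\<bar> \<le> 1"
    "\<And>x. x \<in> V \<Longrightarrow> 0 < into_z x \<Longrightarrow> d x = real n"
    "\<And>y. y \<in> V \<Longrightarrow> 0 < w x0 y \<Longrightarrow> y \<noteq> x0 \<Longrightarrow> d y = 1"
proof -
  let ?E = "edges V w"
  define D where "D x = (LEAST k. k = n \<or> (x0, x) \<in> ?E ^^ k)" for x
  have D: "D x = n \<or> (x0, x) \<in> ?E ^^ D x" for x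
    unfolding D_def by (rule LeastI[of _ n]) simp
  have D_le: "D x \<le> k" if "k = n \<or> (x0, x) \<in> ?E ^^ k" for x k
    unfolding D_def using that by (rule Least_le)
  have step: "D y \<le> Suc (D x)" if "x \<in> V" "y \<in> V" "0 < w x y" for x y
  proof (cases "D x = n")
    case True
    thus ?thesis using D_le[of n y] by simp
  next
    case False
    hence "(x0, y) \<in> ?E ^^ Suc (D x)"
      using D[of x] that by (auto simp: edges_def)
    thus ?thesis by (intro D_le) simp
  qed
  have D0: "real (D x0) = 0" using D_le[of 0 x0] by simp
  have lip: "\<bar>real (D y) - real (D x)\<bar> \<le> 1" if "x \<in> V" "y \<in> V" "0 < w x y" for x y
    using step[OF that] step[of y x] that weight_sym[of x y] by auto
  have exit: "real (D x) = real n" if x: "x \<in> V" "0 < into_z x" for x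
  proof (rule ccontr)
    assume neq: "real (D x) \<noteq> real n"
    have "\<exists>y\<in>z. w x y \<noteq> 0"
      using x(2) infsum_0[of z "w x"] unfolding into_z_def by (metis less_irrefl)
    then obtain y where y: "y \<in> z" "w x y \<noteq> 0" by blast
    hence "(x, y) \<in> ?E" using z_V x weight_nonneg[of x y] by (auto simp: edges_def)
    hence "(x0, y) \<in> ?E ^^ Suc (D x)" using D[of x] neq by auto
    hence "graph_dist V w x0 z \<le> enat (Suc (D x))"
      unfolding graph_dist_def using y by (intro INF_lower) auto
    also have "\<dots> < enat (n + 1)" using D_le[of n x] neq by simp
    finally show False using far by simp
  qed
  have first: "real (D y) = 1" if "y \<in> V" "0 < w x0 y" "y \<noteq> x0" for y
  proof -
    have "D y \<noteq> 0" using D[of y] that(3) n by (cases "D y") auto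
    moreover have "D y \<le> 1" using step[OF x0_V that(1,2)] D0 by simp
    ultimately show ?thesis by simp
  qed
  show thesis by (rule that[of "\<lambda>x. real (D x)"]) (fact D0 lip exit first)+
qed

theorem proposition3:
  fixes V :: "'a set" and w :: "'a \<Rightarrow> 'a \<Rightarrow> real" and x0 :: 'a and z :: "'a set"
    and n :: nat and g :: real
    and M :: "'m measure" and X :: "nat \<Rightarrow> 'm \<Rightarrow> 'a"
    and N :: "'k measure" and S :: "nat \<Rightarrow> 'k \<Rightarrow> int"
    and a :: real
  assumes "weighted_graph V w"
    and "x0 \<in> V" and "z \<subseteq> V"
    and "graph_dist V w x0 z \<ge> enat (n + 1)"
    and "vertex_weight V w summable_on z"
    and "(g > 1 \<and>
          (g - 1)\<^sup>2 * g powi (int n - 2) = 2 * set_weight V w z / vertex_weight V w x0) \<or>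
         (n \<ge> 1 \<and> effective_resistance V w x0 z < \<infinity> \<and>
          g = (set_weight V w z * enn2real (effective_resistance V w x0 z)) powr (1 / real n))"
    and "markov_chain M X (walk_prob V w) x0"
    and "markov_chain N S (biased_prob g) 0"
    and "a \<ge> 0"
  shows "laplace N (\<lambda>\<omega>. hitting_time S {int n} \<omega> + 1) a \<ge> laplace M (hitting_time X z) a"
proof -
  have x0_z: "x0 \<notin> z"
  proof
    assume "x0 \<in> z"
    hence "graph_dist V w x0 z \<le> enat 0"
      unfolding graph_dist_def by (intro INF_lower) auto
    hence "enat (n + 1) \<le> enat 0" using assms(4) by (rule order.trans[rotated])
    thus False by simp
  qed
  have pM: "prob_space M" and pN: "prob_space N"
    using assms(7,8) by (simp_all add: markov_chain_def)
  interpret graph_walk V w x0 z M X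
    by (intro graph_walk.intro graph_target.intro discrete_chain.intro discrete_chain_axioms.intro pM assms x0_z)
  interpret N: discrete_chain N S "biased_prob g" 0
    by (intro discrete_chain.intro discrete_chain_axioms.intro pN assms)
  define B where "B = set_weight V w z"
  have B0: "0 \<le> B" unfolding B_def set_weight_def
    using z_V by (intro infsum_nonneg vertex_weight_nonneg) auto
  show ?thesis
  proof (cases "n = 0")
    case True
    have "laplace M (hitting_time X z) a \<le> (\<Sum>k<1. exp (- a) ^ k * first_hit z k) + exp (- a) ^ 1"
      by (rule laplace_le_sum[OF assms(9)])
    also have "\<dots> = exp (- a) * 1" using first_hit_0[OF x0_z] by simp
    also have "\<dots> \<le> exp (- a) * laplace N (hitting_time S {int n}) a"
    proof (intro mult_left_mono)
      have "1 = (\<Sum>k<1. exp (- a) ^ k * N.first_hit {int n} k)" using True N.first_hit_start[of "{0}"] by simp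
      also have "\<dots> \<le> laplace N (hitting_time S {int n}) a" by (rule N.laplace_ge_sum[OF assms(9)])
      finally show "1 \<le> laplace N (hitting_time S {int n}) a" .
    qed auto
    finally show ?thesis unfolding N.laplace_plus_1 .
  next
    case False
    hence n: "1 \<le> n" by simp
    let ?r = "enn2real (effective_resistance V w x0 z)"
    have growth: "1 < g \<and> 0 < B \<and> 2 * (B / vertex_weight V w x0) \<le> g ^ n * (1 - 1 / g)\<^sup>2
      \<or> 1 \<le> g \<and> 0 < B \<and> effective_resistance V w x0 z < \<infinity> \<and> g ^ n = B * ?r"
      using assms(6)
    proof
      assume a: "g > 1 \<and> (g - 1)\<^sup>2 * g powi (int n - 2) = 2 * set_weight V w z / vertex_weight V w x0"
      hence g: "1 < g" by simp
      have "g powi (int n - 2) = g ^ n / g\<^sup>2"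
        using g by (simp add: power_int_diff)
      moreover have "1 - 1 / g = (g - 1) / g" using g by (simp add: diff_divide_distrib)
      ultimately have "(g - 1)\<^sup>2 * g powi (int n - 2) = g ^ n * (1 - 1 / g)\<^sup>2"
        by (simp add: power_divide)
      hence eq: "2 * (B / vertex_weight V w x0) = g ^ n * (1 - 1 / g)\<^sup>2" using a by (simp add: B_def)
      have "0 < g ^ n * (1 - 1 / g)\<^sup>2" using g by simp
      hence "0 < 2 * (B / vertex_weight V w x0)" unfolding eq .
      hence "B \<noteq> 0" by auto
      thus ?thesis using eq g B0 by simp
    next
      assume b: "1 \<le> n \<and> effective_resistance V w x0 z < \<infinity> \<and> g = (set_weight V w z * ?r) powr (1 / real n)"
      hence Br: "1 \<le> B * ?r" using weight_resistance_ge_1 by (simp add: B_def)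
      hence "B \<noteq> 0" by auto
      moreover have "1 \<le> g" using b Br by (simp add: B_def ge_one_powr_ge_zero)
      moreover have "g ^ n = B * ?r"
      proof -
        have "g ^ n = g powr real n" using \<open>1 \<le> g\<close> by (simp add: powr_realpow)
        also have "\<dots> = B * ?r" using b n Br by (simp add: powr_powr B_def)
        finally show ?thesis .
      qed
      ultimately show ?thesis using b B0 by simp
    qed
    hence g: "1 \<le> g" and B: "0 < B" by auto
    interpret N: biased_walk N S g by unfold_locales (rule g)
    show ?thesis
    proof (cases "a = 0")
      case True
      have "laplace M (hitting_time X z) a \<le> 1" using assms(9) by (rule laplace_le_1)
      also have "\<dots> \<le> laplace N (hitting_time S {int n}) 0" by (rule N.laplace_0_ge_1[OF n])
      finally show ?thesis unfolding N.laplace_plus_1 using True by simp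
    next
      case False
      hence a: "0 < a" using assms(9) by simp
      define s where "s = exp (- a)"
      have s: "0 < s" "s < 1" using a by (auto simp: s_def)
      obtain d :: "'a \<Rightarrow> real" where d: "d x0 = 0"
        "\<And>x y. x \<in> V \<Longrightarrow> y \<in> V \<Longrightarrow> 0 < w x y \<Longrightarrow> \<bar>d y - d x\<bar> \<le> 1"
        "\<And>x. x \<in> V \<Longrightarrow> 0 < into_z x \<Longrightarrow> d x = real n"
        "\<And>y. y \<in> V \<Longrightarrow> 0 < w x0 y \<Longrightarrow> y \<noteq> x0 \<Longrightarrow> d y = 1"
        using distance_profile[OF assms(4) n] by blast
      have hit_le_laplace: "killed_network.hit W w (vertex_weight V w) into_z s x0 \<le> s * laplace N (hitting_time S {int n}) a"
        if W: "finite W" "W \<subseteq> V - z" "x0 \<in> W" for W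
      proof -
        interpret K: killed_network W w "vertex_weight V w" into_z x0 by (rule killed_network[OF W])
        have WV: "x \<in> V" if "x \<in> W" for x using that W by auto
        show ?thesis
        proof (cases "0 < K.hit s x0")
          case True
          have "\<exists>h. 0 < h \<and> h \<le> 1 \<and> K.hit s x0 = s * h ^ n \<and> (g + 1) * h \<le> s * (g + h\<^sup>2)"
          proof (rule K.hit_src_subsolution[of d n g B])
            show "(\<Sum>x\<in>W. into_z x) \<le> B" unfolding B_def using W by (intro sum_into_z_le) auto
            show "1 < g \<and> 2 * (B / vertex_weight V w x0) \<le> g ^ n * (1 - 1 / g)\<^sup>2
                \<or> (\<forall>s. 0 < s \<longrightarrow> s < 1 \<longrightarrow> K.green s x0 * B \<le> g ^ n)"
              using growth
            proof
              assume b: "1 \<le> g \<and> 0 < B \<and> effective_resistance V w x0 z < \<infinity> \<and> g ^ n = B * ?r"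
              have "K.green s x0 * B \<le> g ^ n" if "0 < s" "s < 1" for s
                using green_le_resistance[OF _ W that] b mult_left_mono[of "K.green s x0" ?r B]
                by (simp add: mult.commute)
              thus ?thesis by blast
            qed blast
          qed (use d WV n g B s True in auto)
          then obtain h where h: "0 < h" "h \<le> 1" "K.hit s x0 = s * h ^ n" "(g + 1) * h \<le> s * (g + h\<^sup>2)"
            by blast
          have "h ^ n \<le> laplace N (hitting_time S {int n}) a"
            using h(4) unfolding s_def by (intro N.laplace_ge_power n h a)
          thus ?thesis unfolding h(3) using s by (intro mult_left_mono) auto
        next
          case False
          thus ?thesis using mult_nonneg_nonneg[of s "laplace N (hitting_time S {int n}) a"] s N.laplace_nonneg
            by (smt (verit))
        qed
      qed
      have "laplace M (hitting_time X z) a \<le> s * laplace N (hitting_time S {int n}) a"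
      proof (rule field_le_epsilon)
        fix \<delta> :: real assume "0 < \<delta>"
        then obtain W where W: "finite W" "W \<subseteq> V - z" "x0 \<in> W"
          "laplace M (hitting_time X z) a \<le> killed_network.hit W w (vertex_weight V w) into_z s x0 + \<delta>"
          using laplace_le_hit[OF a] unfolding s_def by blast
        thus "laplace M (hitting_time X z) a \<le> s * laplace N (hitting_time S {int n}) a + \<delta>"
          using hit_le_laplace[OF W(1,2,3)] by linarith
      qed
      thus ?thesis unfolding N.laplace_plus_1 s_def .
    qed
  qed
qed

end
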